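(* Let $A=[(A_\varepsilon)_\varepsilon]\in M(n,\widetilde{\mathbb R})$ be skew-symmetric. For each $\varepsilon$ let $\theta_{k,\varepsilon}=\mu_{k,\varepsilon}+i\nu_{k,\varepsilon}$ ($1\le k\le n$; $\mu_{k,\varepsilon},\nu_{k,\varepsilon}\in\mathbb R$) be the (complex) eigenvalues of $A_\varepsilon$ (counted with multiplicity), ordered by the size of their imaginary parts: $\nu_{1,\varepsilon}\ge\dots\ge\nu_{n,\varepsilon}$, and set $\theta_k:=[(\theta_{k,\varepsilon})_\varepsilon]\in\widetilde{\mathbb C}$ ($1\le k\le n$). Then $\theta_1,\dots,\theta_n$ are well-defined elements of $\widetilde{\mathbb C}$, independent of the representative $(A_\varepsilon)_\varepsilon$ of $A$. They are of the form $\pm i\lambda_k$ with $\lambda_k\in\widetilde{\mathbb R}$. If $n$ is odd, then at least one $\lambda_k$ equals $0$. In particular, if $A$ is non-degenerate then $n$ must be even. Any eigenvalue of $A$ (regarded as an element of $M(n,\widetilde{\mathbb C})$) is an interleaving of $\{\theta_1,\dots,\theta_n\}$.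
   Context: For $\mathbb K=\mathbb R$ or $\mathbb C$, the ring of Colombeau generalized numbers is $\widetilde{\mathbb K}=\mathcal E_M/\mathcal N$, where $\mathcal E_M=\{(r_\varepsilon)_{\varepsilon\in(0,1]}\in\mathbb K^{(0,1]}:\exists N\in\mathbb N,\ |r_\varepsilon|=O(\varepsilon^{-N})\ (\varepsilon\to0)\}$ and $\mathcal N=\{(r_\varepsilon)_{\varepsilon\in(0,1]}\in\mathbb K^{(0,1]}:\forall m\in\mathbb N,\ |r_\varepsilon|=O(\varepsilon^{m})\ (\varepsilon\to0)\}$, with operations defined componentwise on representatives; $[(r_\varepsilon)_\varepsilon]$ denotes the class of $(r_\varepsilon)_\varepsilon$, and $\widetilde{\mathbb R}\subseteq\widetilde{\mathbb C}$. $M(n,\widetilde{\mathbb K})$ is the set of $n\times n$ matrices with entries in $\widetilde{\mathbb K}$. A representative of $A\in M(n,\widetilde{\mathbb K})$ is a net $(A_\varepsilon)_{\varepsilon\in(0,1]}$ of matrices in $M(n,\mathbb K)$ whose entries are representatives of the entries of $A$; one writes $A=[(A_\varepsilon)_\varepsilon]$. $A$ is skew-symmetric if $A^t=-A$. $A\in M(n,\widetilde{\mathbb K})$ is non-degenerate if for $x\in\widetilde{\mathbb K}^n$, $x^tAy=0$ for all $y\in\widetilde{\mathbb K}^n$ implies $x=0$. A vector $x\in\widetilde{\mathbb C}^n$ is free if $\mu x=0$ with $\mu\in\widetilde{\mathbb C}$ implies $\mu=0$. $\lambda\in\widetilde{\mathbb C}$ is an eigenvalue of $A\in M(n,\widetilde{\mathbb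 C})$ if there is a free $x\in\widetilde{\mathbb C}^n$ with $Ax=\lambda x$. For $S\subseteq(0,1]$, $e_S$ is the class of the characteristic function of $S$. $\lambda\in\widetilde{\mathbb C}$ is an interleaving of $\{\theta_1,\dots,\theta_n\}\subseteq\widetilde{\mathbb C}$ if there is a partition $\{S_1,\dots,S_n\}$ of $(0,1]$ (empty parts allowed) with $\lambda=\theta_1e_{S_1}+\dots+\theta_ne_{S_n}$. *)

theory Defs
  imports
    Complex_Main
    "HOL-Library.Landau_Symbols"
    "HOL-Library.Disjoint_Sets"
    "HOL-Library.Indicator_Function"
    "Jordan_Normal_Form.Char_Poly"
begin

section \<open>Colombeau generalized numbers\<close>

text \<open>
  Nets are indexed by \<open>(0,1]\<close>. They are modelled as functions on all of \<open>real\<close>, of which only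
  the values on \<open>{0<..1}\<close> are meant: moderateness and negligibility depend only on the values
  near \<open>0\<close> from the right, so the values elsewhere do not influence the quotient.
\<close>

definition moderate :: "(real \<Rightarrow> 'a::real_normed_field) \<Rightarrow> bool" where
  "moderate r \<longleftrightarrow> (\<exists>N::nat. (\<lambda>\<epsilon>. norm (r \<epsilon>)) \<in> O[at_right 0](\<lambda>\<epsilon>. 1 / \<epsilon> ^ N))"

definition negligible :: "(real \<Rightarrow> 'a::real_normed_field) \<Rightarrow> bool" where
  "negligible r \<longleftrightarrow> (\<forall>m::nat. (\<lambda>\<epsilon>. norm (r \<epsilon>)) \<in> O[at_right 0](\<lambda>\<epsilon>. \<epsilon> ^ m))"

lemma eventually_unit_interval: "\<forall>\<^sub>F \<epsilon>::real in at_right 0. 0 < \<epsilon> \<and> \<epsilon> < 1"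
  using eventually_at_right[of "0::real" 1] by (auto intro: exI[of _ 1])

lemma bigo_power_mono:
  assumes "k \<le> m"
  shows "(\<lambda>\<epsilon>::real. \<epsilon> ^ m) \<in> O[at_right 0](\<lambda>\<epsilon>. \<epsilon> ^ k)"
proof (rule bigoI[where c = 1])
  show "\<forall>\<^sub>F \<epsilon>::real in at_right 0. norm (\<epsilon> ^ m) \<le> 1 * norm (\<epsilon> ^ k)"
    using eventually_unit_interval
    by eventually_elim (use assms in \<open>auto simp: power_decreasing\<close>)
qed

lemma bigo_inverse_power_mono:
  assumes "k \<le> m"
  shows "(\<lambda>\<epsilon>::real. 1 / \<epsilon> ^ k) \<in> O[at_right 0](\<lambda>\<epsilon>. 1 / \<epsilon> ^ m)"
proof (rule bigoI[where c = 1])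
  show "\<forall>\<^sub>F \<epsilon>::real in at_right 0. norm (1 / \<epsilon> ^ k) \<le> 1 * norm (1 / \<epsilon> ^ m)"
    using eventually_unit_interval
    by eventually_elim (use assms in \<open>auto simp: power_decreasing divide_simps\<close>)
qed

lemma moderate_const [simp, intro]: "moderate (\<lambda>_. c)"
  unfolding moderate_def by (rule exI[of _ 0]) simp

lemma moderate_add:
  assumes "moderate r" "moderate s"
  shows "moderate (\<lambda>\<epsilon>. r \<epsilon> + s \<epsilon>)"
proof -
  obtain N M where
    r: "(\<lambda>\<epsilon>. norm (r \<epsilon>)) \<in> O[at_right 0](\<lambda>\<epsilon>. 1 / \<epsilon> ^ N)" and
    s: "(\<lambda>\<epsilon>. norm (s \<epsilon>)) \<in> O[at_right 0](\<lambda>\<epsilon>. 1 / \<epsilon> ^ M)"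
    using assms unfolding moderate_def by blast
  have "(\<lambda>\<epsilon>. norm (r \<epsilon>)) \<in> O[at_right 0](\<lambda>\<epsilon>. 1 / \<epsilon> ^ max N M)"
    "(\<lambda>\<epsilon>. norm (s \<epsilon>)) \<in> O[at_right 0](\<lambda>\<epsilon>. 1 / \<epsilon> ^ max N M)"
    using landau_o.big_trans[OF r bigo_inverse_power_mono[of N "max N M"]]
      landau_o.big_trans[OF s bigo_inverse_power_mono[of M "max N M"]]
    by simp_all
  then have "(\<lambda>\<epsilon>. norm (r \<epsilon>) + norm (s \<epsilon>)) \<in> O[at_right 0](\<lambda>\<epsilon>. 1 / \<epsilon> ^ max N M)"
    by (rule sum_in_bigo)
  moreover have "(\<lambda>\<epsilon>. norm (r \<epsilon> + s \<epsilon>)) \<in> O[at_right 0](\<lambda>\<epsilon>. norm (r \<epsilon>) + norm (s \<epsilon>))"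
    by (rule bigoI[where c = 1]) (auto simp: norm_triangle_ineq)
  ultimately show ?thesis
    unfolding moderate_def by (meson landau_o.big_trans)
qed

lemma moderate_mult:
  assumes "moderate r" "moderate s"
  shows "moderate (\<lambda>\<epsilon>. r \<epsilon> * s \<epsilon>)"
proof -
  obtain N M where
    "(\<lambda>\<epsilon>. norm (r \<epsilon>)) \<in> O[at_right 0](\<lambda>\<epsilon>. 1 / \<epsilon> ^ N)"
    "(\<lambda>\<epsilon>. norm (s \<epsilon>)) \<in> O[at_right 0](\<lambda>\<epsilon>. 1 / \<epsilon> ^ M)"
    using assms unfolding moderate_def by blast
  then have "(\<lambda>\<epsilon>. norm (r \<epsilon>) * norm (s \<epsilon>)) \<in> O[at_right 0](\<lambda>\<epsilon>. 1 / \<epsilon> ^ N * (1 / \<epsilon> ^ M))"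
    by (rule landau_o.big_mult)
  then have "(\<lambda>\<epsilon>. norm (r \<epsilon> * s \<epsilon>)) \<in> O[at_right 0](\<lambda>\<epsilon>. 1 / \<epsilon> ^ (N + M))"
    by (simp add: norm_mult power_add)
  then show ?thesis
    unfolding moderate_def by blast
qed

lemma moderate_minus: "moderate r \<Longrightarrow> moderate (\<lambda>\<epsilon>. - r \<epsilon>)"
  unfolding moderate_def by simp

lemma negligible_zero [simp, intro]: "negligible (\<lambda>_. 0)"
  unfolding negligible_def by simp

lemma negligible_add:
  assumes "negligible r" "negligible s"
  shows "negligible (\<lambda>\<epsilon>. r \<epsilon> + s \<epsilon>)"
  unfolding negligible_def
proof
  fix m
  have "(\<lambda>\<epsilon>. norm (r \<epsilon>) + norm (s \<epsilon>)) \<in> O[at_right 0](\<lambda>\<epsilon>. \<epsilon> ^ m)"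
    using assms unfolding negligible_def by (intro sum_in_bigo) auto
  moreover have "(\<lambda>\<epsilon>. norm (r \<epsilon> + s \<epsilon>)) \<in> O[at_right 0](\<lambda>\<epsilon>. norm (r \<epsilon>) + norm (s \<epsilon>))"
    by (rule bigoI[where c = 1]) (auto simp: norm_triangle_ineq)
  ultimately show "(\<lambda>\<epsilon>. norm (r \<epsilon> + s \<epsilon>)) \<in> O[at_right 0](\<lambda>\<epsilon>. \<epsilon> ^ m)"
    by (meson landau_o.big_trans)
qed

lemma negligible_minus: "negligible r \<Longrightarrow> negligible (\<lambda>\<epsilon>. - r \<epsilon>)"
  unfolding negligible_def by simp

lemma negligible_mult:
  assumes "negligible r" "moderate s"
  shows "negligible (\<lambda>\<epsilon>. r \<epsilon> * s \<epsilon>)"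
  unfolding negligible_def
proof
  fix m
  obtain N where N: "(\<lambda>\<epsilon>. norm (s \<epsilon>)) \<in> O[at_right 0](\<lambda>\<epsilon>. 1 / \<epsilon> ^ N)"
    using assms(2) unfolding moderate_def by blast
  have "(\<lambda>\<epsilon>. norm (r \<epsilon>)) \<in> O[at_right 0](\<lambda>\<epsilon>. \<epsilon> ^ (m + N))"
    using assms(1) unfolding negligible_def by blast
  from landau_o.big_mult[OF this N]
  have "(\<lambda>\<epsilon>. norm (r \<epsilon> * s \<epsilon>)) \<in> O[at_right 0](\<lambda>\<epsilon>. \<epsilon> ^ (m + N) * (1 / \<epsilon> ^ N))"
    by (simp add: norm_mult)
  moreover have "(\<lambda>\<epsilon>::real. \<epsilon> ^ (m + N) * (1 / \<epsilon> ^ N)) \<in> O[at_right 0](\<lambda>\<epsilon>. \<epsilon> ^ m)"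
  proof (rule bigoI[where c = 1])
    show "\<forall>\<^sub>F \<epsilon>::real in at_right 0. norm (\<epsilon> ^ (m + N) * (1 / \<epsilon> ^ N)) \<le> 1 * norm (\<epsilon> ^ m)"
      using eventually_unit_interval
      by eventually_elim (auto simp: power_add)
  qed
  ultimately show "(\<lambda>\<epsilon>. norm (r \<epsilon> * s \<epsilon>)) \<in> O[at_right 0](\<lambda>\<epsilon>. \<epsilon> ^ m)"
    by (meson landau_o.big_trans)
qed

lemma not_negligible_one: "\<not> negligible (\<lambda>_. 1 :: 'a::real_normed_field)"
proof
  assume "negligible (\<lambda>_. 1 :: 'a)"
  then have "(\<lambda>\<epsilon>. norm (1 :: 'a)) \<in> O[at_right 0](\<lambda>\<epsilon>::real. \<epsilon> ^ 1)"
    unfolding negligible_def by blast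
  then obtain c :: real where c: "c > 0" "\<forall>\<^sub>F \<epsilon> in at_right 0. (1::real) \<le> c * \<bar>\<epsilon>\<bar>"
    by (auto elim!: landau_o.bigE)
  have "\<forall>\<^sub>F \<epsilon> in at_right (0::real). \<epsilon> < 1 / c"
    using c(1) eventually_at_right[of "0::real" "1 / c"] by (auto intro!: exI[of _ "1 / c"])
  with c(2) eventually_unit_interval have "\<forall>\<^sub>F \<epsilon> in at_right (0::real). False"
    by eventually_elim (use c(1) in \<open>auto simp: field_simps\<close>)
  then show False
    by (simp add: eventually_False trivial_limit_at_right_real)
qed

definition colombeau_rel ::
    "(real \<Rightarrow> 'a::real_normed_field) \<Rightarrow> (real \<Rightarrow> 'a) \<Rightarrow> bool" where
  "colombeau_rel r s \<longleftrightarrow> moderate r \<and> moderate s \<and> negligible (\<lambda>\<epsilon>. r \<epsilon> - s \<epsilon>)"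

text \<open>
  \<open>colombeau_class r\<close> is the class \<open>[(r\<^sub>\<epsilon>)\<^sub>\<epsilon>]\<close>; it is meaningful only for moderate \<open>r\<close>.
  The generalized real and complex numbers are \<open>real colombeau\<close> and \<open>complex colombeau\<close>.
\<close>

quotient_type (overloaded) 'a colombeau = "real \<Rightarrow> 'a::real_normed_field" / partial: colombeau_rel
  morphisms colombeau_rep colombeau_class
proof (rule part_equivpI)
  show "\<exists>r :: real \<Rightarrow> 'a. colombeau_rel r r"
    by (rule exI[of _ "\<lambda>_. 0"]) (simp add: colombeau_rel_def)
  show "symp (colombeau_rel :: (real \<Rightarrow> 'a) \<Rightarrow> _)"
    by (rule sympI) (use negligible_minus in \<open>fastforce simp: colombeau_rel_def\<close>)
  show "transp (colombeau_rel :: (real \<Rightarrow> 'a) \<Rightarrow> _)"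
  proof (rule transpI)
    fix r s t :: "real \<Rightarrow> 'a"
    assume "colombeau_rel r s" "colombeau_rel s t"
    then show "colombeau_rel r t"
      using negligible_add[of "\<lambda>\<epsilon>. r \<epsilon> - s \<epsilon>" "\<lambda>\<epsilon>. s \<epsilon> - t \<epsilon>"]
      by (simp add: colombeau_rel_def)
  qed
qed

lemma colombeau_class_eq_iff:
  assumes "moderate r" "moderate s"
  shows "colombeau_class r = colombeau_class s \<longleftrightarrow> negligible (\<lambda>\<epsilon>. r \<epsilon> - s \<epsilon>)"
  using assms Quotient_rel[OF Quotient_colombeau, of r s]
  by (auto simp: colombeau_rel_def)

instantiation colombeau :: (real_normed_field) comm_ring_1
begin

lift_definition zero_colombeau :: "'a colombeau" is "\<lambda>_. 0"
  by (simp add: colombeau_rel_def)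

lift_definition one_colombeau :: "'a colombeau" is "\<lambda>_. 1"
  by (simp add: colombeau_rel_def)

lift_definition plus_colombeau :: "'a colombeau \<Rightarrow> 'a colombeau \<Rightarrow> 'a colombeau"
  is "\<lambda>r s \<epsilon>. r \<epsilon> + s \<epsilon>"
proof -
  fix r r' s s' :: "real \<Rightarrow> 'a"
  assume "colombeau_rel r r'" "colombeau_rel s s'"
  then show "colombeau_rel (\<lambda>\<epsilon>. r \<epsilon> + s \<epsilon>) (\<lambda>\<epsilon>. r' \<epsilon> + s' \<epsilon>)"
    using negligible_add[of "\<lambda>\<epsilon>. r \<epsilon> - r' \<epsilon>" "\<lambda>\<epsilon>. s \<epsilon> - s' \<epsilon>"]
    by (simp add: colombeau_rel_def moderate_add algebra_simps)
qed

lift_definition uminus_colombeau :: "'a colombeau \<Rightarrow> 'a colombeau"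
  is "\<lambda>r \<epsilon>. - r \<epsilon>"
proof -
  fix r r' :: "real \<Rightarrow> 'a"
  assume "colombeau_rel r r'"
  then show "colombeau_rel (\<lambda>\<epsilon>. - r \<epsilon>) (\<lambda>\<epsilon>. - r' \<epsilon>)"
    using negligible_minus[of "\<lambda>\<epsilon>. r \<epsilon> - r' \<epsilon>"]
    by (simp add: colombeau_rel_def moderate_minus)
qed

definition minus_colombeau :: "'a colombeau \<Rightarrow> 'a colombeau \<Rightarrow> 'a colombeau" where
  "minus_colombeau a b = a + - b"

lift_definition times_colombeau :: "'a colombeau \<Rightarrow> 'a colombeau \<Rightarrow> 'a colombeau"
  is "\<lambda>r s \<epsilon>. r \<epsilon> * s \<epsilon>"
proof -
  fix r r' s s' :: "real \<Rightarrow> 'a"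
  assume *: "colombeau_rel r r'" "colombeau_rel s s'"
  then have "negligible (\<lambda>\<epsilon>. (r \<epsilon> - r' \<epsilon>) * s \<epsilon> + (s \<epsilon> - s' \<epsilon>) * r' \<epsilon>)"
    by (intro negligible_add negligible_mult) (auto simp: colombeau_rel_def)
  also have "(\<lambda>\<epsilon>. (r \<epsilon> - r' \<epsilon>) * s \<epsilon> + (s \<epsilon> - s' \<epsilon>) * r' \<epsilon>) = (\<lambda>\<epsilon>. r \<epsilon> * s \<epsilon> - r' \<epsilon> * s' \<epsilon>)"
    by (simp add: algebra_simps)
  finally show "colombeau_rel (\<lambda>\<epsilon>. r \<epsilon> * s \<epsilon>) (\<lambda>\<epsilon>. r' \<epsilon> * s' \<epsilon>)"
    using * by (simp add: colombeau_rel_def moderate_mult)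
qed

instance
proof
  fix a b c :: "'a colombeau"
  show "a + b + c = a + (b + c)"
    by transfer (simp add: colombeau_rel_def moderate_add add.assoc)
  show "a + b = b + a"
    by transfer (simp add: colombeau_rel_def moderate_add add.commute)
  show "0 + a = a"
    by transfer (simp add: colombeau_rel_def)
  show "- a + a = 0"
    by transfer (simp add: colombeau_rel_def)
  show "a - b = a + - b"
    by (simp add: minus_colombeau_def)
  show "a * b * c = a * (b * c)"
    by transfer (simp add: colombeau_rel_def moderate_mult mult.assoc)
  show "a * b = b * a"
    by transfer (simp add: colombeau_rel_def moderate_mult mult.commute)
  show "1 * a = a"
    by transfer (simp add: colombeau_rel_def)
  show "(a + b) * c = a * c + b * c"
    by transfer (simp add: colombeau_rel_def moderate_add moderate_mult distrib_right)
  show "(0 :: 'a colombeau) \<noteq> 1"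
    by transfer (use not_negligible_one negligible_minus in \<open>fastforce simp: colombeau_rel_def\<close>)
qed

end

lift_definition complex_of_gen :: "real colombeau \<Rightarrow> complex colombeau"
  is "\<lambda>r \<epsilon>. complex_of_real (r \<epsilon>)"
  by (simp add: colombeau_rel_def moderate_def negligible_def flip: of_real_diff)

definition gen_ii :: "complex colombeau" where
  "gen_ii = colombeau_class (\<lambda>_. \<i>)"

definition gen_indicator :: "real set \<Rightarrow> complex colombeau" where
  "gen_indicator S = colombeau_class (indicator S)"

text \<open>The family \<open>\<theta>\<close> is read on the indices \<open>1, \<dots>, n\<close>; the parts \<open>S k\<close> may be empty.\<close>

definition interleaving :: "nat \<Rightarrow> (nat \<Rightarrow> complex colombeau) \<Rightarrow> complex colombeau \<Rightarrow> bool" where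
  "interleaving n \<theta> l \<longleftrightarrow>
     (\<exists>S :: nat \<Rightarrow> real set.
        disjoint_family_on S {1..n} \<and> (\<Union>k\<in>{1..n}. S k) = {0<..1} \<and>
        l = (\<Sum>k\<in>{1..n}. \<theta> k * gen_indicator (S k)))"

section \<open>Matrices of generalized numbers\<close>

definition mat_representative ::
    "nat \<Rightarrow> (real \<Rightarrow> 'a::real_normed_field mat) \<Rightarrow> 'a colombeau mat \<Rightarrow> bool" where
  "mat_representative n A\<^sub>\<epsilon> A \<longleftrightarrow>
     A \<in> carrier_mat n n \<and> (\<forall>\<epsilon>\<in>{0<..1}. A\<^sub>\<epsilon> \<epsilon> \<in> carrier_mat n n) \<and>
     (\<forall>i<n. \<forall>j<n. moderate (\<lambda>\<epsilon>. A\<^sub>\<epsilon> \<epsilon> $$ (i, j)) \<and>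
        colombeau_class (\<lambda>\<epsilon>. A\<^sub>\<epsilon> \<epsilon> $$ (i, j)) = A $$ (i, j))"

definition skew_symmetric_mat :: "'a::comm_ring_1 mat \<Rightarrow> bool" where
  "skew_symmetric_mat A \<longleftrightarrow> transpose_mat A = - A"

definition nondegenerate_mat :: "nat \<Rightarrow> 'a::comm_ring_1 mat \<Rightarrow> bool" where
  "nondegenerate_mat n A \<longleftrightarrow>
     (\<forall>x\<in>carrier_vec n. (\<forall>y\<in>carrier_vec n. x \<bullet> (A *\<^sub>v y) = 0) \<longrightarrow> x = 0\<^sub>v n)"

definition free_vec :: "nat \<Rightarrow> complex colombeau vec \<Rightarrow> bool" where
  "free_vec n x \<longleftrightarrow> x \<in> carrier_vec n \<and> (\<forall>\<mu>. \<mu> \<cdot>\<^sub>v x = 0\<^sub>v n \<longrightarrow> \<mu> = 0)"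

text \<open>
  Eigenvectors are required to be free. This is stronger than the requirement
  \<open>x \<noteq> 0\<close> in \<^const>\<open>eigenvalue\<close>, as generalized numbers have zero divisors.
\<close>

definition gen_eigenvalue :: "nat \<Rightarrow> complex colombeau mat \<Rightarrow> complex colombeau \<Rightarrow> bool" where
  "gen_eigenvalue n A l \<longleftrightarrow> (\<exists>x. free_vec n x \<and> A *\<^sub>v x = l \<cdot>\<^sub>v x)"

text \<open>
  \<open>t 1, \<dots>, t n\<close> enumerate the complex eigenvalues of the real matrix \<open>B\<close> with their algebraic
  multiplicities, by decreasing imaginary part. The order of eigenvalues with equal imaginary
  parts is left open.
\<close>

definition ordered_eigenvalues :: "nat \<Rightarrow> real mat \<Rightarrow> (nat \<Rightarrow> complex) \<Rightarrow> bool" where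
  "ordered_eigenvalues n B t \<longleftrightarrow>
     image_mset t (mset_set {1..n}) = proots (char_poly (map_mat complex_of_real B)) \<and>
     (\<forall>j\<in>{1..n}. \<forall>k\<in>{1..n}. j \<le> k \<longrightarrow> Im (t k) \<le> Im (t j))"

lemma ordered_eigenvalues_exist:
  assumes "B \<in> carrier_mat n n"
  shows "\<exists>t. ordered_eigenvalues n B t"
proof -
  let ?p = "char_poly (map_mat complex_of_real B)"
  have B: "map_mat complex_of_real B \<in> carrier_mat n n"
    using assms by simp
  obtain xs where xs: "mset xs = proots ?p"
    using ex_mset by blast
  define ys where "ys = sort_key (\<lambda>z. - Im z) xs"
  have "length ys = size (proots ?p)"
    using xs by (simp add: ys_def flip: size_mset)
  also have "\<dots> = n"
    using degree_monic_char_poly[OF B] by (simp add: size_proots_complex)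
  finally have len: "length ys = n" .
  have "image_mset (\<lambda>k. ys ! (k - 1)) (mset_set {1..n}) = image_mset (\<lambda>k. ys ! k) (mset_set {0..<n})"
  proof -
    have "mset_set {1..n} = image_mset Suc (mset_set {0..<n})"
      by (simp add: image_mset_mset_set image_Suc_atLeastLessThan atLeastLessThanSuc_atLeastAtMost)
    then show ?thesis
      by (simp add: multiset.map_comp comp_def)
  qed
  also have "\<dots> = mset ys"
    using len by (metis map_nth mset_map mset_upt)
  also have "\<dots> = proots ?p"
    by (simp add: ys_def xs)
  finally have 1: "image_mset (\<lambda>k. ys ! (k - 1)) (mset_set {1..n}) = proots ?p" .
  have "sorted (map (\<lambda>z. - Im z) ys)"
    by (simp add: ys_def)
  then have "Im (ys ! (k - 1)) \<le> Im (ys ! (j - 1))"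
    if "j \<in> {1..n}" "k \<in> {1..n}" "j \<le> k" for j k
    using that len sorted_nth_mono[of "map (\<lambda>z. - Im z) ys" "j - 1" "k - 1"] by simp
  with 1 show ?thesis
    unfolding ordered_eigenvalues_def by blast
qed

text \<open>Here \<open>\<theta> k \<epsilon>\<close> stands for \<open>\<theta>\<^sub>k\<^sub>,\<^sub>\<epsilon>\<close>.\<close>

definition ordered_eigenvalue_nets ::
    "nat \<Rightarrow> (real \<Rightarrow> real mat) \<Rightarrow> (nat \<Rightarrow> real \<Rightarrow> complex) \<Rightarrow> bool" where
  "ordered_eigenvalue_nets n A\<^sub>\<epsilon> \<theta> \<longleftrightarrow>
     (\<forall>\<epsilon>\<in>{0<..1}. ordered_eigenvalues n (A\<^sub>\<epsilon> \<epsilon>) (\<lambda>k. \<theta> k \<epsilon>))"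

end

theory Submission
  imports Defs "Jordan_Normal_Form.Schur_Decomposition"
begin

text \<open>
  Triangularise each \<open>A\<^sub>\<epsilon> = U T U\<^sup>*\<close> unitarily, with the eigenvalues on the diagonal in the prescribed
  order. As \<open>T + T\<^sup>* = U\<^sup>* (A\<^sub>\<epsilon> + A\<^sub>\<epsilon>\<^sup>t) U\<close> is negligible, \<open>T\<close> is diagonal up to negligible errors
  and the real parts of the eigenvalues are negligible. For two representatives,
  \<open>W = U\<^sup>* V\<close> then satisfies \<open>(\<theta>\<^sub>i - \<eta>\<^sub>j) W\<^sub>i\<^sub>j \<approx> 0\<close>, which forces the sorted imaginary parts together.
  The symmetry \<open>\<theta>\<^bsub>n+1-k\<^esub> = - \<theta>\<^sub>k\<close> is independence applied to the conjugate eigenvalues of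
  the same real matrices. If \<open>A x = \<lambda> x\<close>, let \<open>\<theta>\<^bsub>k(\<epsilon>),\<epsilon>\<^esub>\<close> be the eigenvalue closest to \<open>\<lambda>\<^sub>\<epsilon>\<close> and
  \<open>\<mu>\<close> the class of \<open>\<theta>\<^bsub>k(\<epsilon>),\<epsilon>\<^esub> - \<lambda>\<^sub>\<epsilon>\<close>; then \<open>\<mu> x = 0\<close>, so \<open>\<mu> = 0\<close> by freeness, and the level sets of
  \<open>k\<close> are the interleaving.
\<close>

section \<open>Unitary triangularisation\<close>

lemma mat_adjoint_carrier [simp, intro]:
  "A \<in> carrier_mat n m \<Longrightarrow> mat_adjoint A \<in> carrier_mat m n"
  unfolding mat_adjoint_def carrier_mat_def by simp

lemma mat_adjoint_dim [simp]:
  "dim_row (mat_adjoint A) = dim_col A" "dim_col (mat_adjoint A) = dim_row A"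
  unfolding mat_adjoint_def by simp_all

lemma mat_adjoint_index [simp]:
  fixes A :: "complex mat"
  assumes "i < dim_col A" "j < dim_row A"
  shows "mat_adjoint A $$ (i, j) = cnj (A $$ (j, i))"
  using assms unfolding mat_adjoint_def by (simp add: mat_of_rows_def)

lemma mat_adjoint_mult:
  fixes A B :: "complex mat"
  assumes "A \<in> carrier_mat n m" "B \<in> carrier_mat m l"
  shows "mat_adjoint (A * B) = mat_adjoint B * mat_adjoint A"
  using assms by (intro eq_matI) (auto simp: scalar_prod_def mult.commute)

definition unitary_mat :: "nat \<Rightarrow> complex mat \<Rightarrow> bool" where
  "unitary_mat n U \<longleftrightarrow> U \<in> carrier_mat n n \<and> mat_adjoint U * U = 1\<^sub>m n"

lemma unitary_matD:
  assumes "unitary_mat n U"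
  shows "U \<in> carrier_mat n n" "mat_adjoint U * U = 1\<^sub>m n" "U * mat_adjoint U = 1\<^sub>m n"
  using assms mat_mult_left_right_inverse[of "mat_adjoint U" n U] by (auto simp: unitary_mat_def)

lemma unitary_mat_mult:
  assumes "unitary_mat n U" "unitary_mat n V"
  shows "unitary_mat n (U * V)"
proof -
  note U = unitary_matD[OF assms(1)] and V = unitary_matD[OF assms(2)]
  note U' = mat_adjoint_carrier[OF U(1)] and V' = mat_adjoint_carrier[OF V(1)]
  have "mat_adjoint (U * V) * (U * V) = mat_adjoint V * (mat_adjoint U * (U * V))"
    using mat_adjoint_mult[OF U(1) V(1)] assoc_mult_mat[OF V' U', of "U * V" n] U(1) V(1) by simp
  also have "mat_adjoint U * (U * V) = V"
    using assoc_mult_mat[OF U' U(1) V(1)] U(2) V(1) by simp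
  finally have "mat_adjoint (U * V) * (U * V) = 1\<^sub>m n"
    using V(2) by simp
  then show ?thesis
    using U V by (simp add: unitary_mat_def)
qed

lemma unitary_mat_adjoint:
  assumes "unitary_mat n U"
  shows "unitary_mat n (mat_adjoint U)"
proof -
  note U = unitary_matD[OF assms]
  have "mat_adjoint (mat_adjoint U) = U"
    using U(1) by (intro eq_matI) auto
  then show ?thesis
    using U by (simp add: unitary_mat_def)
qed

text \<open>Lifts the unitary matrix of the deflated block to full size in the induction step of
  \<open>unitary_schur\<close>.\<close>

lemma unitary_mat_block:
  assumes "unitary_mat n U"
  shows "unitary_mat (Suc n) (four_block_mat (1\<^sub>m 1) (0\<^sub>m 1 n) (0\<^sub>m n 1) U)"
proof -
  note U = unitary_matD[OF assms]
  let ?F = "four_block_mat (1\<^sub>m 1) (0\<^sub>m 1 n) (0\<^sub>m n 1) U"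
  have adj: "mat_adjoint ?F = four_block_mat (1\<^sub>m 1) (0\<^sub>m 1 n) (0\<^sub>m n 1) (mat_adjoint U)"
    using U(1) by (intro eq_matI) auto
  have "mat_adjoint ?F * ?F =
      four_block_mat (1\<^sub>m 1) (0\<^sub>m 1 n) (0\<^sub>m n 1) (1\<^sub>m n)"
    unfolding adj using U
    by (subst mult_four_block_mat[of _ 1 1 _ n _ n _ _ 1 _ n]) auto
  also have "\<dots> = 1\<^sub>m (Suc n)"
    by (intro eq_matI) auto
  finally show ?thesis
    using U(1) by (auto simp: unitary_mat_def)
qed

section \<open>Unitary Schur form with a prescribed diagonal\<close>

text \<open>Complete \<open>v\<close> to a basis and apply Gram-Schmidt, which leaves the first
  vector unchanged; rescaling the orthogonal vectors to unit length gives the columns. With an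
  eigenvector for \<open>v\<close>, conjugation by \<open>W\<close> splits off its
  eigenvalue.\<close>

lemma ex_unitary_mat_first_col:
  fixes v :: "complex vec"
  assumes v: "v \<in> carrier_vec n" and v0: "v \<noteq> 0\<^sub>v n" and n: "0 < n"
  shows "\<exists>W c. unitary_mat n W \<and> col W 0 = c \<cdot>\<^sub>v v"
proof -
  interpret cof_vec_space n "TYPE(complex)" .
  define b where "b = basis_completion v"
  from basis_completion[OF v v0, folded b_def]
  have b: "distinct b" "\<not> lin_dep (set b)" "set b \<subseteq> carrier_vec n" "hd b = v" "length b = n"
    by auto
  define ws where "ws = gram_schmidt n b"
  from gram_schmidt_result[OF b(3) b(1) b(2) ws_def] b(5)
  have ws: "set ws \<subseteq> carrier_vec n" "corthogonal ws" "length ws = n"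
    by auto
  have hd_ws: "ws ! 0 = v"
    using gram_schmidt_hd[OF v, of "tl b"] b(4,5) n ws(3) unfolding ws_def
    by (metis hd_Cons_tl hd_conv_nth length_greater_0_conv)
  \<comment> \<open>\<open>corthogonal\<close> gives nonzero squared lengths, not unit length. The
    factor is the inverse length; being real, it is unaffected by \<open>cnj\<close>.\<close>
  define c where "c j = complex_of_real (1 / sqrt (Re (ws ! j \<bullet>c ws ! j)))" for j
  define W where "W = mat n n (\<lambda>(i, j). c j * ws ! j $ i)"
  have ws_carrier: "ws ! j \<in> carrier_vec n" if "j < n" for j
    using ws that by auto
  have "mat_adjoint W * W = 1\<^sub>m n"
  proof (rule eq_matI)
    fix i j assume "i < dim_row (1\<^sub>m n)" "j < dim_col (1\<^sub>m n)"
    then have ij: "i < n" "j < n"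
      by auto
    have "(mat_adjoint W * W) $$ (i, j) =
        (\<Sum>k<n. cnj (c i) * cnj (ws ! i $ k) * (c j * ws ! j $ k))"
      using ij by (simp add: W_def scalar_prod_def atLeast0LessThan)
    also have "\<dots> = cnj (c i) * c j * (ws ! j \<bullet>c ws ! i)"
      using ij carrier_vecD[OF ws_carrier[of i]]
      by (simp add: scalar_prod_def atLeast0LessThan sum_distrib_left mult_ac)
    also have "\<dots> = (if i = j then 1 else 0)"
    proof (cases "i = j")
      case True
      have nz: "ws ! i \<bullet>c ws ! i \<noteq> 0"
        using corthogonalD[OF ws(2), of i i] ij ws(3) by simp
      obtain r where r: "ws ! i \<bullet>c ws ! i = complex_of_real r" "0 \<le> r"
      proof
        show "ws ! i \<bullet>c ws ! i = complex_of_real (\<Sum>k<n. (cmod (ws ! i $ k))\<^sup>2)"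
          using ij carrier_vecD[OF ws_carrier[of i]]
          by (simp add: scalar_prod_def atLeast0LessThan flip: complex_norm_square of_real_power)
      qed (auto intro: sum_nonneg)
      have "cnj (c i) * c i * (ws ! i \<bullet>c ws ! i) =
          complex_of_real (1 / sqrt r * (1 / sqrt r) * r)"
        by (simp only: c_def r Re_complex_of_real of_real_mult complex_cnj_complex_of_real)
      also have "1 / sqrt r * (1 / sqrt r) * r = 1"
        using r nz by (simp add: field_simps)
      finally show ?thesis
        using True by simp
    next
      case False
      then show ?thesis
        using corthogonalD[OF ws(2), of j i] ij ws(3) by simp
    qed
    finally show "(mat_adjoint W * W) $$ (i, j) = 1\<^sub>m n $$ (i, j)"
      using ij by simp
  qed (simp_all add: W_def)
  then have "unitary_mat n W"
    by (simp add: unitary_mat_def W_def)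
  moreover have "col W 0 = c 0 \<cdot>\<^sub>v v"
    using v n hd_ws by (intro eq_vecI) (auto simp: W_def)
  ultimately show ?thesis
    by blast
qed

text \<open>Deflation: an eigenvector for the first entry of the list becomes the first column of a
  unitary matrix, and induction treats the remaining block. Any root can be split off first, so the
  diagonal can follow any order of \<open>es\<close>; the sorted order is what the comparison of
  eigenvalues relies on.\<close>

lemma unitary_schur:
  fixes A :: "complex mat"
  assumes "A \<in> carrier_mat n n" "char_poly A = (\<Prod>e\<leftarrow>es. [:- e, 1:])"
  shows "\<exists>U T. unitary_mat n U \<and> T \<in> carrier_mat n n \<and> A * U = U * T \<and>
    upper_triangular T \<and> diag_mat T = es"
  using assms
proof (induction es arbitrary: n A)
  case Nil
  then have "n = 0"
    using degree_monic_char_poly[of A n] by simp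
  then show ?case
    using Nil by (intro exI[of _ "1\<^sub>m 0"] exI[of _ A]) (auto simp: unitary_mat_def diag_mat_def)
next
  case (Cons e es)
  note A = Cons.prems(1)
  have "degree (char_poly A) = Suc (length es)"
    using degree_linear_factors[of uminus "e # es"] Cons.prems(2) by simp
  then obtain m where n: "n = Suc m"
    using degree_monic_char_poly[OF A] by auto
  have "eigenvalue A e"
    unfolding eigenvalue_root_char_poly[OF A] Cons.prems(2) by simp
  then obtain v where v: "v \<in> carrier_vec n" "v \<noteq> 0\<^sub>v n" "A *\<^sub>v v = e \<cdot>\<^sub>v v"
    using A unfolding eigenvalue_def eigenvector_def by auto
  obtain W c where "unitary_mat n W" and col: "col W 0 = c \<cdot>\<^sub>v v"
    using ex_unitary_mat_first_col[OF v(1,2)] n by blast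
  note W = unitary_matD[OF this(1)] this(1)
  let ?W' = "mat_adjoint W"
  have W': "?W' \<in> carrier_mat n n"
    using W by simp
  define A' where "A' = ?W' * (A * W)"
  have A': "A' \<in> carrier_mat n n"
    unfolding A'_def using A W W' by (intro mult_carrier_mat[of _ n n])
  have AW: "A * W = W * A'"
    unfolding A'_def using A W W' assoc_mult_mat[of W n n ?W' n "A * W" n] by simp
  have "col (A * W) 0 = e \<cdot>\<^sub>v col W 0"
    using n by (simp add: col_mult2[OF A W(1)] col mult_mat_vec[OF A v(1)] v(3) smult_smult_assoc
      mult.commute)
  \<comment> \<open>The first column of \<open>A * W\<close> is \<open>e\<close> times that of
    \<open>W\<close>, and \<open>?W' * W\<close> is the identity, so the first column of
    \<open>A'\<close> is \<open>e\<close> times the first unit vector.\<close>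
  then have A'0: "A' $$ (i, 0) = (if i = 0 then e else 0)" if "i < n" for i
  proof -
    have "A' $$ (i, 0) = row ?W' i \<bullet> col (A * W) 0"
      unfolding A'_def using that A W W' n by simp
    also have "\<dots> = e * (row ?W' i \<bullet> col W 0)"
      using \<open>col (A * W) 0 = _\<close> W(1) W' n that
      by (simp add: scalar_prod_smult_distrib[of _ n])
    also have "row ?W' i \<bullet> col W 0 = (?W' * W) $$ (i, 0)"
      using that W(1) W' n by simp
    finally show ?thesis
      unfolding W(2) using that n by simp
  qed
  define A1 where "A1 = mat 1 1 (\<lambda>_. e)"
  define A2 where "A2 = mat 1 m (\<lambda>(i, j). A' $$ (0, Suc j))"
  define A3 where "A3 = mat m m (\<lambda>(i, j). A' $$ (Suc i, Suc j))"
  have carriers: "A1 \<in> carrier_mat 1 1" "A2 \<in> carrier_mat 1 m" "A3 \<in> carrier_mat m m"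
    by (simp_all add: A1_def A2_def A3_def)
  have block: "A' = four_block_mat A1 A2 (0\<^sub>m m 1) A3"
    using A' n A'0 by (intro eq_matI) (auto simp: A1_def A2_def A3_def)
  have "similar_mat A' A"
    unfolding similar_mat_def
    by (intro exI, rule similar_mat_witI[of ?W' W n])
      (use A A' W W' in \<open>auto simp: A'_def assoc_mult_mat[of _ n n _ n _ n]\<close>)
  \<comment> \<open>Cancelling the linear factor of the corner block leaves the factorisation of
    \<open>char_poly A3\<close> over \<open>es\<close> that the induction hypothesis
    requires.\<close>
  have "char_poly A1 * char_poly A3 = char_poly A'"
    unfolding block by (rule char_poly_four_block_zeros_col[OF carriers, symmetric])
  also have "\<dots> = char_poly A"
    by (rule char_poly_similar) fact
  also have "\<dots> = [:- e, 1:] * (\<Prod>e\<leftarrow>es. [:- e, 1:])"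
    by (simp only: Cons.prems(2) list.map prod_list.Cons)
  finally have "char_poly A1 * char_poly A3 = [:- e, 1:] * (\<Prod>e\<leftarrow>es. [:- e, 1:])" .
  moreover have "char_poly A1 = [:- e, 1:]"
    by (simp add: A1_def char_poly_defs det_def sign_def)
  ultimately have "char_poly A3 = (\<Prod>e\<leftarrow>es. [:- e, 1:])"
    by (metis mult_cancel_left pCons_eq_0_iff zero_neq_one)
  from Cons.IH[OF carriers(3) this] obtain P T where P: "unitary_mat m P" and T: "T \<in> carrier_mat m m"
    and PT: "A3 * P = P * T" and ut: "upper_triangular T" and diag: "diag_mat T = es"
    by blast
  have P': "P \<in> carrier_mat m m"
    using P by (simp add: unitary_mat_def)
  let ?F = "four_block_mat (1\<^sub>m 1) (0\<^sub>m 1 m) (0\<^sub>m m 1) P"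
  let ?T = "four_block_mat A1 (A2 * P) (0\<^sub>m m 1) T"
  have F: "?F \<in> carrier_mat n n" and T': "?T \<in> carrier_mat n n"
    using P' T carriers n by auto
  have "A' * ?F = four_block_mat A1 (A2 * P) (0\<^sub>m m 1) (A3 * P)"
    unfolding block using carriers P'
    by (subst mult_four_block_mat[of _ 1 1 _ m _ m _ _ 1 _ m]) auto
  also have "\<dots> = ?F * ?T"
    unfolding PT using carriers P' T
    by (subst mult_four_block_mat[of _ 1 1 _ m _ m _ _ 1 _ m]) auto
  finally have A'F: "A' * ?F = ?F * ?T" .
  have "A * (W * ?F) = A * W * ?F"
    by (rule assoc_mult_mat[OF A W(1) F, symmetric])
  also have "\<dots> = W * (A' * ?F)"
    unfolding AW by (rule assoc_mult_mat[OF W(1) A' F])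
  also have "\<dots> = W * ?F * ?T"
    unfolding A'F by (rule assoc_mult_mat[OF W(1) F T', symmetric])
  finally have "A * (W * ?F) = W * ?F * ?T" .
  moreover have "unitary_mat n (W * ?F)"
    using unitary_mat_mult[OF W(4)] unitary_mat_block[OF P] n by simp
  moreover have "upper_triangular ?T"
    by (intro upper_triangular_four_block[OF carriers(1) T _ ut]) (auto simp: A1_def)
  moreover have "diag_mat ?T = e # es"
    using diag_four_block_mat[OF carriers(1) T] diag by (simp add: A1_def diag_mat_def)
  ultimately show ?case
    using T' by blast
qed

section \<open>The spectrum of a real matrix and complex conjugation\<close>

text \<open>Brings the multiset of roots into the list form used by \<open>unitary_schur\<close>.
  The shift by \<open>Suc\<close> is needed because eigenvalues are numbered from 1 and matrix
  indices from 0.\<close>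

lemma char_poly_ordered_eigenvalues:
  assumes "B \<in> carrier_mat n n" "ordered_eigenvalues n B t"
  shows "char_poly (map_mat complex_of_real B) = (\<Prod>e\<leftarrow>map (\<lambda>k. t (Suc k)) [0..<n]. [:- e, 1:])"
proof -
  let ?p = "char_poly (map_mat complex_of_real B)"
  have "lead_coeff ?p = 1"
    using degree_monic_char_poly[of "map_mat complex_of_real B" n] assms(1) by simp
  then have "?p = (\<Prod>e\<in>#proots ?p. [:- e, 1:])"
    using complex_poly_decompose_multiset[of ?p] by simp
  also have "proots ?p = image_mset t (mset_set {1..n})"
    using assms(2) by (simp add: ordered_eigenvalues_def)
  also have "mset_set {1..n} = image_mset Suc (mset_set {0..<n})"
    by (simp add: image_mset_mset_set image_Suc_atLeastLessThan atLeastLessThanSuc_atLeastAtMost)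
  also have "(\<Prod>e\<in>#image_mset t (image_mset Suc (mset_set {0..<n})). [:- e, 1:]) =
      (\<Prod>e\<leftarrow>map (\<lambda>k. t (Suc k)) [0..<n]. [:- e, 1:])"
    using prod.distinct_set_conv_list[of "[0..<n]" "\<lambda>k. [:- t (Suc k), 1:]"]
    by (simp add: multiset.map_comp comp_def flip: prod_unfold_prod_mset)
  finally show ?thesis .
qed

text \<open>Conjugating the values of the factorised polynomial at conjugate points yields a second
  factorisation, over the conjugate roots; the multiset of roots can be read off from
  either.\<close>

lemma proots_real_poly_cnj:
  fixes p :: "complex poly"
  assumes "lead_coeff p = 1" "map_poly cnj p = p"
  shows "image_mset cnj (proots p) = proots p"
proof -
  have "p = (\<Prod>e\<in>#image_mset cnj (proots p). [:- e, 1:])"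
  proof (rule poly_eq_poly_eq_iff[THEN iffD1], rule ext)
    fix x
    have "poly p x = cnj (poly p (cnj x))"
      using poly_map_poly_cnj[of p x] assms(2) by simp
    also have "poly p (cnj x) = poly (\<Prod>e\<in>#proots p. [:- e, 1:]) (cnj x)"
      using complex_poly_decompose_multiset[of p] assms(1) by simp
    also have "cnj (poly (\<Prod>e\<in>#M. [:- e, 1:]) (cnj x)) =
        poly (\<Prod>e\<in>#image_mset cnj M. [:- e, 1:]) x" for M
      by (induction M) (auto simp: algebra_simps)
    finally show "poly p x = poly (\<Prod>e\<in>#image_mset cnj (proots p). [:- e, 1:]) x" .
  qed
  then have "proots p = proots (\<Prod>e\<in>#image_mset cnj (proots p). [:- e, 1:])"
    by (rule arg_cong)
  also have "\<dots> = image_mset cnj (proots p)"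
  proof -
    have "proots (\<Prod>e\<in>#M. [:- e, 1:]) = M" for M :: "complex multiset"
    proof (induction M)
      case (add x M)
      have "(\<Prod>e\<in>#M. [:- e, 1:]) \<noteq> 0"
        by (auto simp: prod_mset_zero_iff)
      then have "proots ([:- x, 1:] * (\<Prod>e\<in>#M. [:- e, 1:])) = {#x#} + M"
        using add.IH by (subst proots_mult) auto
      then show ?case
        by simp
    qed simp
    then show ?thesis
      by blast
  qed
  finally show ?thesis ..
qed

text \<open>Conjugation preserves the spectrum but reverses the order of the imaginary parts; the
  index reversal \<open>n + 1 - k\<close> restores it.\<close>

lemma ordered_eigenvalues_cnj:
  assumes "B \<in> carrier_mat n n" "ordered_eigenvalues n B t"
  shows "ordered_eigenvalues n B (\<lambda>k. cnj (t (n + 1 - k)))"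
proof -
  let ?p = "char_poly (map_mat complex_of_real B)"
  have lead: "lead_coeff ?p = 1"
    using degree_monic_char_poly[of "map_mat complex_of_real B" n] assms(1) by simp
  have "?p = map_poly complex_of_real (char_poly B)"
    by (rule of_real_hom.char_poly_hom[OF assms(1)])
  then have real: "map_poly cnj ?p = ?p"
    by (intro poly_eqI) (simp add: coeff_map_poly)
  have "bij_betw (\<lambda>k. n + 1 - k) {1..n} {1..n}"
    by (rule bij_betw_byWitness[where f' = "\<lambda>k. n + 1 - k"]) auto
  then have "image_mset (\<lambda>k. n + 1 - k) (mset_set {1..n}) = mset_set {1..n}"
    by (simp add: bij_betw_def image_mset_mset_set)
  then have "image_mset (\<lambda>k. cnj (t (n + 1 - k))) (mset_set {1..n}) =
      image_mset cnj (image_mset t (mset_set {1..n}))"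
    by (metis (no_types, lifting) image_mset_cong multiset.map_comp comp_def)
  moreover have "Im (t (n + 1 - j)) \<le> Im (t (n + 1 - k))"
    if "j \<in> {1..n}" "k \<in> {1..n}" "j \<le> k" for j k
  proof -
    have "n + 1 - k \<in> {1..n}" "n + 1 - j \<in> {1..n}" "n + 1 - k \<le> n + 1 - j"
      using that by auto
    then show ?thesis
      using assms(2) unfolding ordered_eigenvalues_def by blast
  qed
  ultimately show ?thesis
    using assms(2) proots_real_poly_cnj[OF lead real] by (simp add: ordered_eigenvalues_def)
qed

section \<open>Quantitative perturbation theory\<close>

text \<open>The entrywise maximum norm is what representatives control directly. Each matrix product
  costs a factor \<open>n\<close>, which is harmless for negligibility.\<close>

definition entries_bounded :: "nat \<Rightarrow> complex mat \<Rightarrow> real \<Rightarrow> bool" where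
  "entries_bounded n M c \<longleftrightarrow> M \<in> carrier_mat n n \<and> (\<forall>i<n. \<forall>j<n. cmod (M $$ (i, j)) \<le> c)"

lemma entries_bounded_mult:
  assumes "entries_bounded n M a" "entries_bounded n N b" "0 \<le> a"
  shows "entries_bounded n (M * N) (n * a * b)"
proof -
  have "cmod ((M * N) $$ (i, j)) \<le> n * a * b" if "i < n" "j < n" for i j
  proof -
    have "(M * N) $$ (i, j) = (\<Sum>k<n. M $$ (i, k) * N $$ (k, j))"
      using assms that by (auto simp: entries_bounded_def scalar_prod_def atLeast0LessThan)
    also have "cmod \<dots> \<le> (\<Sum>k<n. a * b)"
      using assms that by (intro sum_norm_le) (auto simp: norm_mult entries_bounded_def intro!: mult_mono)
    finally show ?thesis
      by simp
  qed
  then show ?thesis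
    using assms by (auto simp: entries_bounded_def)
qed

lemma unitary_mat_col_sum:
  assumes "unitary_mat n U" "j < n"
  shows "(\<Sum>i<n. (cmod (U $$ (i, j)))\<^sup>2) = 1"
proof -
  note U = unitary_matD[OF assms(1)]
  have "complex_of_real (\<Sum>i<n. (cmod (U $$ (i, j)))\<^sup>2) = (mat_adjoint U * U) $$ (j, j)"
    using U(1) assms(2)
    by (simp add: scalar_prod_def atLeast0LessThan complex_norm_square mult.commute del: of_real_power)
  also have "\<dots> = 1"
    using U(2) assms(2) by simp
  finally show ?thesis
    by (simp only: of_real_eq_1_iff)
qed

lemma unitary_mat_row_sum:
  assumes "unitary_mat n U" "i < n"
  shows "(\<Sum>j<n. (cmod (U $$ (i, j)))\<^sup>2) = 1"
  using unitary_mat_col_sum[OF unitary_mat_adjoint[OF assms(1)] assms(2)] unitary_matD(1)[OF assms(1)] assms(2)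
  by simp

lemma entries_bounded_unitary:
  assumes "unitary_mat n U"
  shows "entries_bounded n U 1"
proof -
  have "cmod (U $$ (i, j)) \<le> 1" if "i < n" "j < n" for i j
  proof -
    have "(cmod (U $$ (i, j)))\<^sup>2 \<le> (\<Sum>i<n. (cmod (U $$ (i, j)))\<^sup>2)"
      using that by (intro member_le_sum) auto
    then show ?thesis
      using unitary_mat_col_sum[OF assms that(2)] by (simp add: power_le_one_iff)
  qed
  then show ?thesis
    using unitary_matD(1)[OF assms] by (simp add: entries_bounded_def)
qed

text \<open>
  This replaces Weyl's inequality: if \<open>a k\<close> exceeded \<open>b k\<close> by more than \<open>n \<eta>\<close>, the first \<open>k + 1\<close>
  rows of \<open>W\<close> would almost live in the first \<open>k\<close> columns, contradicting unitarity.
\<close>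

lemma unitary_intertwiner_sorted:
  fixes a b :: "nat \<Rightarrow> real"
  assumes W: "unitary_mat n W"
    and a: "\<And>i j. i \<le> j \<Longrightarrow> j < n \<Longrightarrow> a j \<le> a i" and b: "\<And>i j. i \<le> j \<Longrightarrow> j < n \<Longrightarrow> b j \<le> b i"
    and eta: "\<And>i j. i < n \<Longrightarrow> j < n \<Longrightarrow> \<bar>a i - b j\<bar> * cmod (W $$ (i, j)) \<le> \<eta>"
    and k: "k < n"
  shows "a k - b k \<le> n * \<eta>"
proof (cases "a k - b k \<le> 0")
  case True
  have "0 \<le> \<bar>a k - b k\<bar> * cmod (W $$ (k, k))"
    by simp
  also have "\<dots> \<le> \<eta>"
    using eta k by blast
  finally show ?thesis
    using True by (meson mult_nonneg_nonneg of_nat_0_le_iff order_trans)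
next
  case False
  define d where "d = a k - b k"
  have d: "0 < d"
    using False by (simp add: d_def)
  have eta0: "0 \<le> \<eta>"
    using eta[OF k k] by (meson abs_ge_zero mult_nonneg_nonneg norm_ge_zero order_trans)
  let ?w = "\<lambda>i j. (cmod (W $$ (i, j)))\<^sup>2"
  \<comment> \<open>The squared moduli in the first \<open>k + 1\<close> rows add up to
    \<open>k + 1\<close>, and the first \<open>k\<close> columns carry at most \<open>k\<close> of
    this. So the block of rows up to \<open>k\<close> and columns from \<open>k\<close> on carries
    at least 1.\<close>
  have "real k + 1 = (\<Sum>i<Suc k. \<Sum>j<n. ?w i j)"
    using unitary_mat_row_sum[OF W] k by simp
  also have "\<dots> = (\<Sum>i<Suc k. (\<Sum>j<k. ?w i j) + (\<Sum>j=k..<n. ?w i j))"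
    using k by (simp add: sum.atLeastLessThan_concat lessThan_atLeast0)
  also have "\<dots> = (\<Sum>j<k. \<Sum>i<Suc k. ?w i j) + (\<Sum>i<Suc k. \<Sum>j=k..<n. ?w i j)"
    unfolding sum.distrib by (subst sum.swap) simp
  also have "(\<Sum>j<k. \<Sum>i<Suc k. ?w i j) \<le> (\<Sum>j<k. \<Sum>i<n. ?w i j)"
    using k by (intro sum_mono sum_mono2) auto
  also have "\<dots> = real k"
    using unitary_mat_col_sum[OF W] k by simp
  also have "(\<Sum>i<Suc k. \<Sum>j=k..<n. ?w i j) \<le> (\<Sum>i<n. \<Sum>j<n. (\<eta> / d)\<^sup>2)"
  proof -
    \<comment> \<open>In this block the ordering of \<open>a\<close> and \<open>b\<close> makes
      every gap at least \<open>d\<close>, so all its entries are at most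
      \<open>\<eta> / d\<close>.\<close>
    have "?w i j \<le> (\<eta> / d)\<^sup>2" if "i < Suc k" "j \<in> {k..<n}" for i j
    proof -
      have "d \<le> a i - b j"
        using a[of i k] b[of k j] that k by (auto simp: d_def)
      then have "d * cmod (W $$ (i, j)) \<le> \<bar>a i - b j\<bar> * cmod (W $$ (i, j))"
        by (intro mult_right_mono) auto
      also have "\<dots> \<le> \<eta>"
        using eta that k by auto
      finally have "cmod (W $$ (i, j)) \<le> \<eta> / d"
        using d by (simp add: field_simps)
      then show ?thesis
        by (intro power_mono) auto
    qed
    then have "(\<Sum>i<Suc k. \<Sum>j=k..<n. ?w i j) \<le> (\<Sum>i<Suc k. \<Sum>j=k..<n. (\<eta> / d)\<^sup>2)"
      by (intro sum_mono) auto
    also have "\<dots> \<le> (\<Sum>i<n. \<Sum>j=k..<n. (\<eta> / d)\<^sup>2)"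
      using k by (intro sum_mono2) (auto intro!: mult_nonneg_nonneg)
    also have "\<dots> \<le> (\<Sum>i<n. \<Sum>j<n. (\<eta> / d)\<^sup>2)"
      by (intro sum_mono sum_mono2) auto
    finally show ?thesis .
  qed
  finally have "1 \<le> (n * (\<eta> / d))\<^sup>2"
    by (simp add: power2_eq_square mult_ac)
  moreover have "0 \<le> n * (\<eta> / d)"
    using eta0 d by simp
  ultimately have "1 \<le> n * (\<eta> / d)"
    by (metis power2_le_imp_le power_one)
  then show ?thesis
    using d by (simp add: field_simps d_def)
qed

section \<open>Nearly skew matrices: Schur form, stability of eigenvalues, approximate
  eigenvectors\<close>

text \<open>What skew-symmetry of a class leaves for one member of a representative: the members
  need not be skew themselves, but their defects \<open>h\<close> form a negligible net.\<close>

definition nearly_skew :: "nat \<Rightarrow> real \<Rightarrow> real mat \<Rightarrow> bool" where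
  "nearly_skew n h B \<longleftrightarrow>
    B \<in> carrier_mat n n \<and> (\<forall>i<n. \<forall>j<n. \<bar>B $$ (i, j) + B $$ (j, i)\<bar> \<le> h)"

lemma nearly_skewD:
  assumes "nearly_skew n h B"
  shows "B \<in> carrier_mat n n" "\<And>i j. i < n \<Longrightarrow> j < n \<Longrightarrow> \<bar>B $$ (i, j) + B $$ (j, i)\<bar> \<le> h"
  using assms by (auto simp: nearly_skew_def)

lemma nearly_skew_schur:
  fixes B :: "real mat"
  assumes "nearly_skew n h B" and t: "ordered_eigenvalues n B t"
  shows "\<exists>U T. unitary_mat n U \<and> T \<in> carrier_mat n n \<and> map_mat complex_of_real B * U = U * T \<and>
    (\<forall>i<n. T $$ (i, i) = t (Suc i)) \<and>
    (\<forall>i<n. \<forall>j<n. i \<noteq> j \<longrightarrow> cmod (T $$ (i, j)) \<le> (real n)\<^sup>2 * h) \<and>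
    (\<forall>i<n. \<bar>Re (t (Suc i))\<bar> \<le> (real n)\<^sup>2 * h)"
proof -
  note B = nearly_skewD(1)[OF assms(1)] and skew = nearly_skewD(2)[OF assms(1)]
  let ?B = "map_mat complex_of_real B"
  have cB: "?B \<in> carrier_mat n n"
    using B by simp
  obtain U T where "unitary_mat n U" and T: "T \<in> carrier_mat n n" and BU: "?B * U = U * T"
    and ut: "upper_triangular T" and diag: "diag_mat T = map (\<lambda>k. t (Suc k)) [0..<n]"
    using unitary_schur[OF cB char_poly_ordered_eigenvalues[OF B t]] by blast
  note U = unitary_matD[OF this(1)] this(1)
  let ?U' = "mat_adjoint U"
  have U': "?U' \<in> carrier_mat n n"
    using U by simp
  have T_diag: "T $$ (i, i) = t (Suc i)" if "i < n" for i
    using arg_cong[OF diag, of "\<lambda>xs. xs ! i"] that T by (simp add: diag_mat_def)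
  have T_eq: "T = ?U' * (?B * U)"
    unfolding BU using assoc_mult_mat[OF U' U(1) T] U(2) T by simp
  have B': "mat_adjoint ?B \<in> carrier_mat n n" and BU': "?B * U \<in> carrier_mat n n"
    using cB U(1) by auto
  \<comment> \<open>The adjoint of \<open>T\<close> is the same product with
    \<open>mat_adjoint ?B\<close> in place of \<open>?B\<close>, so the sum with \<open>T\<close>
    sees only the skewness defect of \<open>B\<close>.\<close>
  have "mat_adjoint T = mat_adjoint (?B * U) * mat_adjoint ?U'"
    unfolding T_eq by (rule mat_adjoint_mult[OF U' BU'])
  also have "mat_adjoint ?U' = U"
    using U(1) by (intro eq_matI) auto
  also have "mat_adjoint (?B * U) = ?U' * mat_adjoint ?B"
    by (rule mat_adjoint_mult[OF cB U(1)])
  also have "?U' * mat_adjoint ?B * U = ?U' * (mat_adjoint ?B * U)"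
    by (rule assoc_mult_mat[OF U' B' U(1)])
  finally have "T + mat_adjoint T = ?U' * (?B * U) + ?U' * (mat_adjoint ?B * U)"
    using T_eq by simp
  also have "\<dots> = ?U' * ((?B + mat_adjoint ?B) * U)"
    using add_mult_distrib_mat[OF cB B' U(1)] mult_add_distrib_mat[OF U' BU', of "mat_adjoint ?B * U"] B' U(1)
    by simp
  finally have eq: "T + mat_adjoint T = ?U' * ((?B + mat_adjoint ?B) * U)" .
  have "entries_bounded n (?B + mat_adjoint ?B) h"
    using B skew by (auto simp: entries_bounded_def simp flip: of_real_add)
  from entries_bounded_mult[OF this entries_bounded_unitary[OF U(4)]]
  \<comment> \<open>The case \<open>n \<noteq> 0\<close> is singled out because nonnegativity of
    \<open>h\<close> is read off from the entry at \<open>(0, 0)\<close>. The two products with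
    unitary matrices give the factor \<open>n\<close> each.\<close>
  have "entries_bounded n ((?B + mat_adjoint ?B) * U) (n * h)" if "n \<noteq> 0"
    using skew[of 0 0] that by fastforce
  from entries_bounded_mult[OF entries_bounded_unitary[OF unitary_mat_adjoint[OF U(4)]] this]
  have "entries_bounded n (T + mat_adjoint T) ((real n)\<^sup>2 * h)" if "n \<noteq> 0"
    using that by (simp add: eq power2_eq_square mult.assoc)
  then have bound: "cmod (T $$ (i, j) + cnj (T $$ (j, i))) \<le> (real n)\<^sup>2 * h" if "i < n" "j < n" for i j
    using that T by (auto simp: entries_bounded_def)
  show ?thesis
  proof (intro exI conjI allI impI)
    \<comment> \<open>Of two mirrored entries one vanishes by triangularity. Above the diagonal
      \<open>bound\<close> then controls the entry alone; below it the entry is zero and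
      \<open>bound\<close> supplies the sign of the right-hand side.\<close>
    show "cmod (T $$ (i, j)) \<le> (real n)\<^sup>2 * h" if "i < n" "j < n" "i \<noteq> j" for i j
    proof (cases "i < j")
      case True
      then show ?thesis
        using bound[of i j] upper_triangularD[OF ut, of i j] that T by simp
    next
      case False
      then show ?thesis
        using order_trans[OF norm_ge_zero bound[of i j]] upper_triangularD[OF ut, of j i] that T by simp
    qed
    show "\<bar>Re (t (Suc i))\<bar> \<le> (real n)\<^sup>2 * h" if "i < n" for i
      using bound[OF that that] T_diag[OF that] by (simp add: complex_add_cnj norm_mult)
  qed (use U(4) T BU T_diag in auto)
qed

text \<open>Reduces a product with a nearly diagonal matrix to its diagonal term, the error being
  due to the off-diagonal entries.\<close>

lemma cmod_sum_remove_le: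
  fixes f g :: "nat \<Rightarrow> complex"
  assumes "\<And>k. k < n \<Longrightarrow> k \<noteq> i \<Longrightarrow> cmod (f k) \<le> a" "\<And>k. k < n \<Longrightarrow> cmod (g k) \<le> b" "i < n" "0 \<le> a" "0 \<le> b"
  shows "cmod ((\<Sum>k<n. f k * g k) - f i * g i) \<le> n * (a * b)"
proof -
  have "(\<Sum>k<n. f k * g k) - f i * g i = (\<Sum>k\<in>{..<n} - {i}. f k * g k)"
    using assms(3) by (simp add: sum.remove[of "{..<n}" i])
  also have "cmod \<dots> \<le> (\<Sum>k\<in>{..<n} - {i}. a * b)"
    using assms by (intro sum_norm_le) (auto simp: norm_mult intro!: mult_mono)
  also have "\<dots> \<le> (\<Sum>k<n. a * b)"
    using assms by (intro sum_mono2) auto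
  finally show ?thesis
    by simp
qed

text \<open>\<open>W = ?U' * V\<close> almost intertwines the Schur forms:
  \<open>S * W - W * T\<close> is the transformed difference of the matrices. As \<open>S\<close>
  and \<open>T\<close> are nearly diagonal, \<open>unitary_intertwiner_sorted\<close> compares the
  imaginary parts; the real parts are small on both sides.\<close>

lemma nearly_skew_eigenvalues_close:
  fixes A B :: "real mat"
  assumes skewA: "nearly_skew n h A" and s: "ordered_eigenvalues n A s"
    and skewB: "nearly_skew n h B" and t: "ordered_eigenvalues n B t"
    and close: "\<And>i j. i < n \<Longrightarrow> j < n \<Longrightarrow> \<bar>A $$ (i, j) - B $$ (i, j)\<bar> \<le> h"
    and k: "k \<in> {1..n}"
  shows "cmod (s k - t k) \<le> (2 * (real n)\<^sup>2 + 2 * real n ^ 4 + real n ^ 3) * h"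
proof -
  obtain U S where "unitary_mat n U" and S': "S \<in> carrier_mat n n"
    "map_mat complex_of_real A * U = U * S" "\<forall>i<n. S $$ (i, i) = s (Suc i)"
    "\<forall>i<n. \<forall>j<n. i \<noteq> j \<longrightarrow> cmod (S $$ (i, j)) \<le> (real n)\<^sup>2 * h"
    "\<forall>i<n. \<bar>Re (s (Suc i))\<bar> \<le> (real n)\<^sup>2 * h"
    using nearly_skew_schur[OF skewA s] by blast
  note U = unitary_matD[OF this(1)] this(1) and S = S'[rule_format]
  obtain V T where "unitary_mat n V" and T': "T \<in> carrier_mat n n"
    "map_mat complex_of_real B * V = V * T" "\<forall>i<n. T $$ (i, i) = t (Suc i)"
    "\<forall>i<n. \<forall>j<n. i \<noteq> j \<longrightarrow> cmod (T $$ (i, j)) \<le> (real n)\<^sup>2 * h"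
    "\<forall>i<n. \<bar>Re (t (Suc i))\<bar> \<le> (real n)\<^sup>2 * h"
    using nearly_skew_schur[OF skewB t] by blast
  note V = unitary_matD[OF this(1)] this(1) and T = T'[rule_format]
  let ?A = "map_mat complex_of_real A" and ?B = "map_mat complex_of_real B" and ?U' = "mat_adjoint U"
  have cA: "?A \<in> carrier_mat n n" and cB: "?B \<in> carrier_mat n n" and U': "?U' \<in> carrier_mat n n"
    using nearly_skewD(1)[OF skewA] nearly_skewD(1)[OF skewB] U by auto
  have n: "n \<noteq> 0"
    using k by auto
  then have h: "0 \<le> h"
    using nearly_skewD(2)[OF skewA, of 0 0] by linarith
  define W where "W = ?U' * V"
  have W: "unitary_mat n W"
    unfolding W_def by (rule unitary_mat_mult[OF unitary_mat_adjoint[OF U(4)] V(4)])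
  note cW = unitary_matD(1)[OF W]
  have W1: "cmod (W $$ (i, j)) \<le> 1" if "i < n" "j < n" for i j
    using entries_bounded_unitary[OF W] that by (simp add: entries_bounded_def)
  define E where "E = ?U' * ((?A - ?B) * V)"
  have E_bound: "cmod (E $$ (i, j)) \<le> (real n)\<^sup>2 * h" if "i < n" "j < n" for i j
  proof -
    have "entries_bounded n (?A - ?B) h"
      using cA cB close by (auto simp: entries_bounded_def simp flip: of_real_diff)
    from entries_bounded_mult[OF entries_bounded_unitary[OF unitary_mat_adjoint[OF U(4)]]
        entries_bounded_mult[OF this entries_bounded_unitary[OF V(4)] h]]
    have "entries_bounded n E ((real n)\<^sup>2 * h)"
      by (simp add: E_def power2_eq_square mult.assoc)
    then show ?thesis
      using that by (simp add: entries_bounded_def)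
  qed
  have UA: "?U' * ?A = S * ?U'"
  proof -
    have "?U' * ?A = ?U' * ?A * (U * ?U')"
      using U U' cA by simp
    also have "\<dots> = ?U' * ?A * U * ?U'"
      by (rule assoc_mult_mat[OF mult_carrier_mat[OF U' cA] U(1) U', symmetric])
    also have "?U' * ?A * U = ?U' * U * S"
      using assoc_mult_mat[OF U' cA U(1)] assoc_mult_mat[OF U' U(1) S(1)] S(2) by simp
    finally show ?thesis
      using U(2) S(1) by simp
  qed
  have "E = ?U' * (?A * V) - ?U' * (?B * V)"
    unfolding E_def using U' cA cB V(1)
    by (simp add: minus_mult_distrib_mat[of _ n n _ _ n] mult_minus_distrib_mat[of _ n n _ n])
  also have "?U' * (?A * V) = S * W"
    unfolding W_def using assoc_mult_mat[OF U' cA V(1)] assoc_mult_mat[OF S(1) U' V(1)] UA by simp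
  also have "?U' * (?B * V) = W * T"
    unfolding W_def T(2) using assoc_mult_mat[OF U' V(1) T(1)] by simp
  finally have E: "E = S * W - W * T" .
  \<comment> \<open>One \<open>(real n)\<^sup>2 * h\<close> comes from \<open>E\<close>, and one
    \<open>real n ^ 3 * h\<close> from the off-diagonal entries of each of \<open>S\<close> and
    \<open>T\<close>.\<close>
  define eta where "eta = ((real n)\<^sup>2 + 2 * real n ^ 3) * h"
  have key: "cmod ((s (Suc i) - t (Suc j)) * W $$ (i, j)) \<le> eta" if ij: "i < n" "j < n" for i j
  proof -
    have SW: "(S * W) $$ (i, j) = (\<Sum>k<n. S $$ (i, k) * W $$ (k, j))"
      using ij S(1) cW by (simp add: scalar_prod_def atLeast0LessThan)
    have WT: "(W * T) $$ (i, j) = (\<Sum>k<n. T $$ (k, j) * W $$ (i, k))"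
      using ij T(1) cW by (simp add: scalar_prod_def atLeast0LessThan mult.commute)
    have "E $$ (i, j) = (S * W) $$ (i, j) - (W * T) $$ (i, j)"
      unfolding E using ij S(1) T(1) cW by simp
    then have "(s (Suc i) - t (Suc j)) * W $$ (i, j) = E $$ (i, j)
        - ((\<Sum>k<n. S $$ (i, k) * W $$ (k, j)) - S $$ (i, i) * W $$ (i, j))
        + ((\<Sum>k<n. T $$ (k, j) * W $$ (i, k)) - T $$ (j, j) * W $$ (i, j))"
      using ij S(3) T(3) SW WT by (simp add: algebra_simps)
    also have "cmod \<dots> \<le> (real n)\<^sup>2 * h + n * ((real n)\<^sup>2 * h * 1) + n * ((real n)\<^sup>2 * h * 1)"
      using ij h S(4) T(4) W1
      by (intro norm_triangle_le norm_triangle_le_diff add_mono E_bound cmod_sum_remove_le) auto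
    also have "\<dots> = eta"
      by (simp add: eta_def algebra_simps power2_eq_square power3_eq_cube)
    finally show ?thesis .
  qed
  have Im_key: "\<bar>Im (s (Suc i)) - Im (t (Suc j))\<bar> * cmod (W $$ (i, j)) \<le> eta" if "i < n" "j < n" for i j
  proof -
    have "\<bar>Im (s (Suc i) - t (Suc j))\<bar> * cmod (W $$ (i, j)) \<le> cmod (s (Suc i) - t (Suc j)) * cmod (W $$ (i, j))"
      by (intro mult_right_mono abs_Im_le_cmod) auto
    then show ?thesis
      using key[OF that] by (simp add: norm_mult)
  qed
  obtain m where m: "k = Suc m" "m < n"
    using k by (cases k) auto
  have sorted: "Im (s (Suc j)) \<le> Im (s (Suc i))" "Im (t (Suc j)) \<le> Im (t (Suc i))" if "i \<le> j" "j < n" for i j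
    using s t that by (auto simp: ordered_eigenvalues_def)
  have "Im (s k) - Im (t k) \<le> n * eta"
    unfolding m(1)
    by (rule unitary_intertwiner_sorted[OF W, where a = "\<lambda>i. Im (s (Suc i))" and b = "\<lambda>i. Im (t (Suc i))"])
      (use sorted Im_key m in auto)
  \<comment> \<open>The adjoint of \<open>W\<close> intertwines in the other direction, so the same
    one-sided bound holds with \<open>s\<close> and \<open>t\<close> exchanged.\<close>
  moreover have "Im (t k) - Im (s k) \<le> n * eta"
    unfolding m(1)
    by (rule unitary_intertwiner_sorted[OF unitary_mat_adjoint[OF W],
        where a = "\<lambda>i. Im (t (Suc i))" and b = "\<lambda>i. Im (s (Suc i))"])
      (use sorted Im_key m cW in \<open>auto simp: abs_minus_commute\<close>)
  ultimately have "\<bar>Im (s k - t k)\<bar> \<le> n * eta"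
    by simp
  moreover have "\<bar>Re (s k - t k)\<bar> \<le> 2 * ((real n)\<^sup>2 * h)"
    using S(5)[OF m(2)] T(5)[OF m(2)] m(1) by simp
  ultimately have "cmod (s k - t k) \<le> 2 * ((real n)\<^sup>2 * h) + n * eta"
    using cmod_le[of "s k - t k"] by linarith
  also have "\<dots> \<le> (2 * (real n)\<^sup>2 + 2 * real n ^ 4 + real n ^ 3) * h"
    using h by (simp add: eta_def algebra_simps power2_eq_square power3_eq_cube power4_eq_xxxx)
  finally show ?thesis .
qed

lemma cmod_mult_mat_vec_le:
  fixes M :: "complex mat"
  assumes "entries_bounded n M 1" "x \<in> carrier_vec n" "\<forall>j<n. cmod (x $ j) \<le> c" "i < n"
  shows "cmod ((M *\<^sub>v x) $ i) \<le> n * c"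
proof -
  have "(M *\<^sub>v x) $ i = (\<Sum>j<n. M $$ (i, j) * x $ j)"
    using assms by (auto simp: entries_bounded_def scalar_prod_def atLeast0LessThan)
  also have "cmod \<dots> \<le> (\<Sum>j<n. 1 * c)"
    using assms
    by (intro sum_norm_le, subst norm_mult, intro mult_mono) (auto simp: entries_bounded_def)
  finally show ?thesis
    by simp
qed

text \<open>If \<open>l\<close> stays at distance \<open>d\<close> from the spectrum, an approximate
  eigenvector for \<open>l\<close> must be small. In the Schur coordinates \<open>y\<close> the
  residual is \<open>(t (Suc i) - l) * y $ i\<close> up to off-diagonal terms, so each coordinate
  times \<open>d\<close> is small; the unitary matrix carries this back to \<open>x\<close>.\<close>

lemma nearly_skew_approx_eigenvector:
  fixes A :: "real mat"
  assumes skew: "nearly_skew n h A" and t: "ordered_eigenvalues n A t"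
    and x: "x \<in> carrier_vec n" "\<forall>i<n. cmod (x $ i) \<le> c"
    and res: "\<forall>i<n. cmod ((map_mat complex_of_real A *\<^sub>v x - l \<cdot>\<^sub>v x) $ i) \<le> r"
    and d: "0 \<le> d" "\<And>k. k \<in> {1..n} \<Longrightarrow> d \<le> cmod (t k - l)"
    and j: "j < n"
  shows "cmod (x $ j) * d \<le> (real n)\<^sup>2 * r + real n ^ 5 * (h * c)"
proof -
  obtain U T where "unitary_mat n U" and T': "T \<in> carrier_mat n n"
    "map_mat complex_of_real A * U = U * T" "\<forall>i<n. T $$ (i, i) = t (Suc i)"
    "\<forall>i<n. \<forall>j<n. i \<noteq> j \<longrightarrow> cmod (T $$ (i, j)) \<le> (real n)\<^sup>2 * h"
    "\<forall>i<n. \<bar>Re (t (Suc i))\<bar> \<le> (real n)\<^sup>2 * h"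
    using nearly_skew_schur[OF skew t] by blast
  note U = unitary_matD[OF this(1)] this(1) and T = T'[rule_format]
  let ?A = "map_mat complex_of_real A" and ?U' = "mat_adjoint U"
  have cA: "?A \<in> carrier_mat n n" and U': "?U' \<in> carrier_mat n n"
    using nearly_skewD(1)[OF skew] U by auto
  have h: "0 \<le> h" and c: "0 \<le> c"
    using nearly_skewD(2)[OF skew j j] x(2)[rule_format, OF j] norm_ge_zero[of "x $ j"] by linarith+
  define y where "y = ?U' *\<^sub>v x"
  have y: "y \<in> carrier_vec n"
    unfolding y_def using U' x by simp
  have xy: "x = U *\<^sub>v y"
    unfolding y_def using assoc_mult_mat_vec[OF U(1) U' x(1)] U(3) x(1) by simp
  have y_bound: "cmod (y $ i) \<le> n * c" if "i < n" for i
    unfolding y_def using cmod_mult_mat_vec_le[OF entries_bounded_unitary[OF unitary_mat_adjoint[OF U(4)]] x] that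
    by blast
  have "?A *\<^sub>v x = U *\<^sub>v (T *\<^sub>v y)"
    unfolding xy using assoc_mult_mat_vec[OF cA U(1) y] assoc_mult_mat_vec[OF U(1) T(1) y] T(2) by simp
  then have "?U' *\<^sub>v (?A *\<^sub>v x) = T *\<^sub>v y"
    using assoc_mult_mat_vec[OF U' U(1), of "T *\<^sub>v y"] U(2) T(1) y by simp
  then have "T *\<^sub>v y - l \<cdot>\<^sub>v y = ?U' *\<^sub>v (?A *\<^sub>v x - l \<cdot>\<^sub>v x)"
    using mult_minus_distrib_mat_vec[OF U', of "?A *\<^sub>v x" "l \<cdot>\<^sub>v x"] cA x(1) U'
    by (simp add: y_def mult_mat_vec[OF U' x(1)])
  then have res': "cmod ((T *\<^sub>v y - l \<cdot>\<^sub>v y) $ i) \<le> n * r" if "i < n" for i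
    using cmod_mult_mat_vec_le[OF entries_bounded_unitary[OF unitary_mat_adjoint[OF U(4)]] _ res that] cA x(1)
    by simp
  have yd: "cmod (y $ i) * d \<le> n * r + real n ^ 4 * (h * c)" if i: "i < n" for i
  proof -
    have "(T *\<^sub>v y - l \<cdot>\<^sub>v y) $ i = (\<Sum>k<n. T $$ (i, k) * y $ k) - l * y $ i"
      using i T(1) y by (simp add: scalar_prod_def atLeast0LessThan)
    then have "(t (Suc i) - l) * y $ i = (T *\<^sub>v y - l \<cdot>\<^sub>v y) $ i
        - ((\<Sum>k<n. T $$ (i, k) * y $ k) - T $$ (i, i) * y $ i)"
      using T(3)[OF i] by (simp add: algebra_simps)
    \<comment> \<open>The residual costs \<open>n * r\<close>. In the second term
      \<open>(real n)\<^sup>2 * h\<close> bounds the off-diagonal entries, \<open>n * c\<close> the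
      coordinates of \<open>y\<close>, and the outer \<open>n\<close> counts the summands.\<close>
    also have "cmod \<dots> \<le> n * r + n * ((real n)\<^sup>2 * h * (n * c))"
      using i h c T(4) y_bound
      by (intro norm_triangle_le_diff add_mono res' cmod_sum_remove_le) auto
    finally have "cmod (t (Suc i) - l) * cmod (y $ i) \<le> n * r + real n ^ 4 * (h * c)"
      by (simp add: norm_mult power2_eq_square power4_eq_xxxx mult_ac)
    moreover have "cmod (y $ i) * d \<le> cmod (y $ i) * cmod (t (Suc i) - l)"
      using d(2)[of "Suc i"] i by (intro mult_left_mono) auto
    ultimately show ?thesis
      by (simp add: mult.commute)
  qed
  have "x $ j = (\<Sum>i<n. U $$ (j, i) * y $ i)"
    using j U(1) y by (subst xy) (simp add: scalar_prod_def atLeast0LessThan)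
  also have "cmod \<dots> \<le> (\<Sum>i<n. 1 * cmod (y $ i))"
    using j entries_bounded_unitary[OF U(4)]
    by (intro sum_norm_le, subst norm_mult, intro mult_right_mono) (auto simp: entries_bounded_def)
  finally have "cmod (x $ j) * d \<le> (\<Sum>i<n. cmod (y $ i)) * d"
    using d(1) by (intro mult_right_mono) auto
  also have "\<dots> \<le> (\<Sum>i<n. n * r + real n ^ 4 * (h * c))"
    unfolding sum_distrib_right using yd by (intro sum_mono) auto
  also have "\<dots> = (real n)\<^sup>2 * r + real n ^ 5 * (h * c)"
    by (simp add: algebra_simps power2_eq_square power_numeral_reduce)
  finally show ?thesis .
qed

lemma nearly_skew_mono: "nearly_skew n h B \<Longrightarrow> h \<le> h' \<Longrightarrow> nearly_skew n h' B"
  by (fastforce simp: nearly_skew_def)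

lemma nearly_skew_Re_eigenvalue_le:
  assumes "nearly_skew n h B" "ordered_eigenvalues n B t" "k \<in> {1..n}"
  shows "\<bar>Re (t k)\<bar> \<le> (real n)\<^sup>2 * h"
proof -
  have "\<forall>i<n. \<bar>Re (t (Suc i))\<bar> \<le> (real n)\<^sup>2 * h"
    using nearly_skew_schur[OF assms(1,2)] by blast
  then show ?thesis
    using assms(3) by (cases k) auto
qed

text \<open>Each eigenvalue is a diagonal entry of a unitary conjugate of \<open>B\<close>. This is
  the source of moderateness of the eigenvalue nets.\<close>

lemma ordered_eigenvalues_cmod_le:
  assumes B: "B \<in> carrier_mat n n" and t: "ordered_eigenvalues n B t"
    and b: "\<And>i j. i < n \<Longrightarrow> j < n \<Longrightarrow> \<bar>B $$ (i, j)\<bar> \<le> b" and k: "k \<in> {1..n}"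
  shows "cmod (t k) \<le> (real n)\<^sup>2 * b"
proof -
  let ?B = "map_mat complex_of_real B"
  have cB: "?B \<in> carrier_mat n n"
    using B by simp
  obtain U T where "unitary_mat n U" and T: "T \<in> carrier_mat n n" and BU: "?B * U = U * T"
    and diag: "diag_mat T = map (\<lambda>k. t (Suc k)) [0..<n]"
    using unitary_schur[OF cB char_poly_ordered_eigenvalues[OF B t]] by blast
  note U = unitary_matD[OF this(1)] this(1)
  obtain i where i: "k = Suc i" "i < n"
    using k by (cases k) auto
  have "0 \<le> b"
    using b[OF i(2) i(2)] by linarith
  moreover have "entries_bounded n ?B b"
    using B b by (auto simp: entries_bounded_def)
  ultimately have "entries_bounded n (mat_adjoint U * (?B * U)) (real n * 1 * (real n * b * 1))"
    by (intro entries_bounded_mult entries_bounded_unitary unitary_mat_adjoint U(4)) auto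
  moreover have "mat_adjoint U * (?B * U) = T"
    unfolding BU using assoc_mult_mat[OF mat_adjoint_carrier[OF U(1)] U(1) T] U(2) T by simp
  ultimately have "cmod (T $$ (i, i)) \<le> real n * 1 * (real n * b * 1)"
    using i by (simp add: entries_bounded_def)
  moreover have "T $$ (i, i) = t k"
    using arg_cong[OF diag, of "\<lambda>xs. xs ! i"] i T by (simp add: diag_mat_def)
  ultimately show ?thesis
    by (simp add: power2_eq_square mult.assoc)
qed

section \<open>Kernel vectors in odd dimension\<close>

text \<open>\<open>B - transpose_mat B\<close> is exactly skew, so its determinant equals its own
  negative when \<open>n\<close> is odd. Unit length of the kernel vector makes a net of such
  vectors moderate and keeps its class from being zero.\<close>

lemma odd_skew_part_kernel:
  fixes B :: "real mat"
  assumes B: "B \<in> carrier_mat n n" and n: "odd n"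
  shows "\<exists>x. (\<Sum>i<n. x i * x i) = 1 \<and> (\<forall>j<n. (\<Sum>i<n. x i * (B $$ (i, j) - B $$ (j, i))) = 0)"
proof -
  define K where "K = B - transpose_mat B"
  have K: "K \<in> carrier_mat n n"
    unfolding K_def using B by (intro minus_carrier_mat transpose_carrier_mat[THEN iffD2])
  have "transpose_mat K = (-1) \<cdot>\<^sub>m K"
    using B by (intro eq_matI) (auto simp: K_def)
  then have "det K = (-1) ^ n * det K"
    using det_transpose[OF K] K by simp
  then have "det K = 0"
    using n by simp
  then obtain v where v: "v \<in> carrier_vec n" "v \<noteq> 0\<^sub>v n" "K *\<^sub>v v = 0\<^sub>v n"
    using det_0_iff_vec_prod_zero[OF K] by blast
  define s where "s = (\<Sum>i<n. v $ i * v $ i)"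
  have "s \<noteq> 0"
  proof
    assume "s = 0"
    then have "\<forall>i<n. v $ i = 0"
      by (simp add: s_def sum_nonneg_eq_0_iff)
    then show False
      using v(1,2) by auto
  qed
  moreover have "0 \<le> s"
    by (simp add: s_def sum_nonneg)
  ultimately have s: "0 < s"
    by simp
  show ?thesis
  proof (intro exI[of _ "\<lambda>i. v $ i / sqrt s"] conjI allI impI)
    have "(\<Sum>i<n. v $ i / sqrt s * (v $ i / sqrt s)) = (\<Sum>i<n. v $ i * v $ i / s)"
      using s by (intro sum.cong) auto
    also have "\<dots> = 1"
      using s by (simp add: s_def flip: sum_divide_distrib)
    finally show "(\<Sum>i<n. v $ i / sqrt s * (v $ i / sqrt s)) = 1" .
    fix j assume j: "j < n"
    \<comment> \<open>The claim multiplies \<open>K\<close> from the left; by skewness this is minus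
      the entry of \<open>K *\<^sub>v v\<close>.\<close>
    have "0 = - (K *\<^sub>v v) $ j / sqrt s"
      using v(3) j by simp
    also have "(K *\<^sub>v v) $ j = (\<Sum>i<n. (B $$ (j, i) - B $$ (i, j)) * v $ i)"
      using j B v(1) by (simp add: K_def scalar_prod_def atLeast0LessThan)
    finally show "(\<Sum>i<n. v $ i / sqrt s * (B $$ (i, j) - B $$ (j, i))) = 0"
      by (simp add: sum_divide_distrib sum_negf[symmetric] algebra_simps diff_divide_distrib sum_subtractf)
  qed
qed

section \<open>Nets\<close>

lemma bigo_dominated:
  fixes r :: "real \<Rightarrow> 'a::real_normed_field" and h :: "real \<Rightarrow> 'b::real_normed_field"
  assumes "\<And>\<epsilon>. \<epsilon> \<in> {0<..1} \<Longrightarrow> norm (r \<epsilon>) \<le> norm (h \<epsilon>)"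
  shows "(\<lambda>\<epsilon>. norm (r \<epsilon>)) \<in> O[at_right 0](\<lambda>\<epsilon>. norm (h \<epsilon>))"
proof (rule bigoI[where c = 1])
  show "\<forall>\<^sub>F \<epsilon> in at_right 0. norm (norm (r \<epsilon>)) \<le> 1 * norm (norm (h \<epsilon>))"
    using eventually_unit_interval by eventually_elim (use assms in auto)
qed

text \<open>Transfers estimates at fixed \<open>\<epsilon>\<close> to nets. The two nets may take
  values in different fields, so a real bound controls a complex net.\<close>

lemma negligible_dominated:
  fixes r :: "real \<Rightarrow> 'a::real_normed_field" and h :: "real \<Rightarrow> 'b::real_normed_field"
  assumes "negligible h" "\<And>\<epsilon>. \<epsilon> \<in> {0<..1} \<Longrightarrow> norm (r \<epsilon>) \<le> norm (h \<epsilon>)"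
  shows "negligible r"
proof -
  have "(\<lambda>\<epsilon>. norm (r \<epsilon>)) \<in> O[at_right 0](\<lambda>\<epsilon>. norm (h \<epsilon>))"
    by (rule bigo_dominated) (rule assms(2))
  then show ?thesis
    using assms(1) landau_o.big_trans unfolding negligible_def by blast
qed

lemma moderate_dominated:
  fixes r :: "real \<Rightarrow> 'a::real_normed_field" and h :: "real \<Rightarrow> 'b::real_normed_field"
  assumes "moderate h" "\<And>\<epsilon>. \<epsilon> \<in> {0<..1} \<Longrightarrow> norm (r \<epsilon>) \<le> norm (h \<epsilon>)"
  shows "moderate r"
proof -
  have "(\<lambda>\<epsilon>. norm (r \<epsilon>)) \<in> O[at_right 0](\<lambda>\<epsilon>. norm (h \<epsilon>))"
    by (rule bigo_dominated) (rule assms(2))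
  then show ?thesis
    using assms(1) landau_o.big_trans unfolding moderate_def by blast
qed

lemma negligible_norm: "negligible r \<Longrightarrow> negligible (\<lambda>\<epsilon>. norm (r \<epsilon>))"
  by (erule negligible_dominated) simp

lemma moderate_norm: "moderate r \<Longrightarrow> moderate (\<lambda>\<epsilon>. norm (r \<epsilon>))"
  by (erule moderate_dominated) simp

lemma negligible_cmult: "negligible r \<Longrightarrow> negligible (\<lambda>\<epsilon>. c * r \<epsilon>)"
  using negligible_mult[OF _ moderate_const[of c]] by (simp add: mult.commute)

lemma negligible_sum:
  assumes "\<And>i. i \<in> I \<Longrightarrow> negligible (f i)"
  shows "negligible (\<lambda>\<epsilon>. \<Sum>i\<in>I. f i \<epsilon>)"
  using assms by (induction I rule: infinite_finite_induct) (auto intro: negligible_add)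

lemma moderate_sum:
  assumes "\<And>i. i \<in> I \<Longrightarrow> moderate (f i)"
  shows "moderate (\<lambda>\<epsilon>. \<Sum>i\<in>I. f i \<epsilon>)"
  using assms by (induction I rule: infinite_finite_induct) (auto intro: moderate_add)

lemma moderate_diff: "moderate r \<Longrightarrow> moderate s \<Longrightarrow> moderate (\<lambda>\<epsilon>. r \<epsilon> - s \<epsilon>)"
  using moderate_add[OF _ moderate_minus] by fastforce

section \<open>Arithmetic of classes in terms of representatives\<close>

lemma colombeau_rel_refl: "moderate r \<Longrightarrow> colombeau_rel r r"
  by (simp add: colombeau_rel_def)

lemma colombeau_class_exhaust:
  obtains r where "moderate r" "c = colombeau_class r"
  using Quotient_abs_rep[OF Quotient_colombeau, of c] Quotient_rep_reflp[OF Quotient_colombeau, of c]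
  by (metis colombeau_rel_def)

lemma colombeau_class_add:
  "moderate r \<Longrightarrow> moderate s \<Longrightarrow>
    colombeau_class r + colombeau_class s = colombeau_class (\<lambda>\<epsilon>. r \<epsilon> + s \<epsilon>)"
  by (simp add: plus_colombeau.abs_eq colombeau_rel_refl)

lemma colombeau_class_mult:
  "moderate r \<Longrightarrow> moderate s \<Longrightarrow>
    colombeau_class r * colombeau_class s = colombeau_class (\<lambda>\<epsilon>. r \<epsilon> * s \<epsilon>)"
  by (simp add: times_colombeau.abs_eq colombeau_rel_refl)

lemma colombeau_class_minus:
  "moderate r \<Longrightarrow> - colombeau_class r = colombeau_class (\<lambda>\<epsilon>. - r \<epsilon>)"
  by (simp add: uminus_colombeau.abs_eq colombeau_rel_refl)

lemma colombeau_class_sum: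
  assumes "\<And>i. i \<in> I \<Longrightarrow> moderate (f i)"
  shows "(\<Sum>i\<in>I. colombeau_class (f i)) = colombeau_class (\<lambda>\<epsilon>. \<Sum>i\<in>I. f i \<epsilon>)"
  using assms
  by (induction I rule: infinite_finite_induct)
    (simp_all add: zero_colombeau.abs_eq colombeau_class_add moderate_sum)

lemma complex_of_gen_class:
  "moderate r \<Longrightarrow> complex_of_gen (colombeau_class r) = colombeau_class (\<lambda>\<epsilon>. complex_of_real (r \<epsilon>))"
  by (simp add: complex_of_gen.abs_eq colombeau_rel_refl)

lemma colombeau_class_eq_0_iff: "moderate r \<Longrightarrow> colombeau_class r = 0 \<longleftrightarrow> negligible r"
  using colombeau_class_eq_iff[of r "\<lambda>_. 0"] by (simp add: zero_colombeau.abs_eq)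

lemma moderate_of_real: "moderate r \<Longrightarrow> moderate (\<lambda>\<epsilon>. complex_of_real (r \<epsilon>))"
  by (erule moderate_dominated) simp

section \<open>Representatives\<close>

text \<open>The sum of the absolute values of all entries serves as one common bound. The predicate
  \<open>P\<close> stands for \<open>moderate\<close> or for \<open>negligible\<close>.\<close>

lemma ex_net_bound:
  fixes P :: "(real \<Rightarrow> real) \<Rightarrow> bool" and f :: "nat \<Rightarrow> nat \<Rightarrow> real \<Rightarrow> real"
  assumes "P (\<lambda>\<epsilon>. \<Sum>i<n. \<Sum>j<n. \<bar>f i j \<epsilon>\<bar>)"
  shows "\<exists>b. P b \<and> (\<forall>\<epsilon>. 0 \<le> b \<epsilon>) \<and> (\<forall>\<epsilon>. \<forall>i<n. \<forall>j<n. \<bar>f i j \<epsilon>\<bar> \<le> b \<epsilon>)"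
proof (intro exI conjI allI impI)
  show "P (\<lambda>\<epsilon>. \<Sum>i<n. \<Sum>j<n. \<bar>f i j \<epsilon>\<bar>)"
    by fact
  show "0 \<le> (\<Sum>i<n. \<Sum>j<n. \<bar>f i j \<epsilon>\<bar>)" for \<epsilon>
    by (intro sum_nonneg) auto
  fix \<epsilon> i j assume ij: "i < n" "j < n"
  have "\<bar>f i j \<epsilon>\<bar> \<le> (\<Sum>j<n. \<bar>f i j \<epsilon>\<bar>)"
    using ij by (intro member_le_sum) auto
  also have "\<dots> \<le> (\<Sum>i<n. \<Sum>j<n. \<bar>f i j \<epsilon>\<bar>)"
    using ij by (intro member_le_sum[where f = "\<lambda>i. \<Sum>j<n. \<bar>f i j \<epsilon>\<bar>"]) (auto intro: sum_nonneg)
  finally show "\<bar>f i j \<epsilon>\<bar> \<le> (\<Sum>i<n. \<Sum>j<n. \<bar>f i j \<epsilon>\<bar>)" .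
qed

lemma mat_representativeD:
  assumes "mat_representative n A A'"
  shows "A' \<in> carrier_mat n n" "\<And>\<epsilon>. \<epsilon> \<in> {0<..1} \<Longrightarrow> A \<epsilon> \<in> carrier_mat n n"
    "\<And>i j. i < n \<Longrightarrow> j < n \<Longrightarrow> moderate (\<lambda>\<epsilon>. A \<epsilon> $$ (i, j))"
    "\<And>i j. i < n \<Longrightarrow> j < n \<Longrightarrow> A' $$ (i, j) = colombeau_class (\<lambda>\<epsilon>. A \<epsilon> $$ (i, j))"
  using assms by (auto simp: mat_representative_def)

lemma mat_representative_moderate_bound:
  fixes A :: "real \<Rightarrow> real mat"
  assumes "mat_representative n A A'"
  shows "\<exists>b :: real \<Rightarrow> real. moderate b \<and> (\<forall>\<epsilon>. 0 \<le> b \<epsilon>) \<and> (\<forall>\<epsilon>. \<forall>i<n. \<forall>j<n. \<bar>A \<epsilon> $$ (i, j)\<bar> \<le> b \<epsilon>)"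
  using mat_representativeD(3)[OF assms]
  by (intro ex_net_bound moderate_sum) (auto intro: moderate_norm[where 'a = real, simplified])

lemma mat_representative_close:
  fixes A B :: "real \<Rightarrow> real mat"
  assumes A: "mat_representative n A A'" and B: "mat_representative n B A'"
  shows "\<exists>d :: real \<Rightarrow> real. negligible d \<and> (\<forall>\<epsilon>. 0 \<le> d \<epsilon>) \<and>
    (\<forall>\<epsilon>. \<forall>i<n. \<forall>j<n. \<bar>A \<epsilon> $$ (i, j) - B \<epsilon> $$ (i, j)\<bar> \<le> d \<epsilon>)"
proof (intro ex_net_bound negligible_sum)
  fix i j assume "i \<in> {..<n}" "j \<in> {..<n}"
  then have "negligible (\<lambda>\<epsilon>. A \<epsilon> $$ (i, j) - B \<epsilon> $$ (i, j))"
    using mat_representativeD(3,4)[OF A, of i j] mat_representativeD(3,4)[OF B, of i j]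
    by (auto simp flip: colombeau_class_eq_iff)
  then show "negligible (\<lambda>\<epsilon>. \<bar>A \<epsilon> $$ (i, j) - B \<epsilon> $$ (i, j)\<bar>)"
    by (drule_tac negligible_norm) simp
qed

lemma mat_representative_nearly_skew:
  assumes A: "mat_representative n A A'" and skew: "skew_symmetric_mat A'"
  shows "\<exists>h :: real \<Rightarrow> real. negligible h \<and> (\<forall>\<epsilon>. 0 \<le> h \<epsilon>) \<and> (\<forall>\<epsilon>\<in>{0<..1}. nearly_skew n (h \<epsilon>) (A \<epsilon>))"
proof -
  have "\<exists>h :: real \<Rightarrow> real. negligible h \<and> (\<forall>\<epsilon>. 0 \<le> h \<epsilon>) \<and>
    (\<forall>\<epsilon>. \<forall>i<n. \<forall>j<n. \<bar>A \<epsilon> $$ (i, j) + A \<epsilon> $$ (j, i)\<bar> \<le> h \<epsilon>)"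
  proof (intro ex_net_bound negligible_sum)
    fix i j assume ij: "i \<in> {..<n}" "j \<in> {..<n}"
    have "transpose_mat A' $$ (i, j) = (- A') $$ (i, j)"
      using skew by (simp add: skew_symmetric_mat_def)
    then have "A' $$ (j, i) = - A' $$ (i, j)"
      using mat_representativeD(1)[OF A] ij by simp
    then have "A' $$ (i, j) + A' $$ (j, i) = 0"
      by simp
    then have "negligible (\<lambda>\<epsilon>. A \<epsilon> $$ (i, j) + A \<epsilon> $$ (j, i))"
      using mat_representativeD(3,4)[OF A] ij
      by (simp add: colombeau_class_add colombeau_class_eq_0_iff moderate_add)
    then show "negligible (\<lambda>\<epsilon>. \<bar>A \<epsilon> $$ (i, j) + A \<epsilon> $$ (j, i)\<bar>)"
      by (drule_tac negligible_norm) simp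
  qed
  then show ?thesis
    using mat_representativeD(2)[OF A] unfolding nearly_skew_def by blast
qed

section \<open>Eigenvalue nets: moderateness, real parts, independence, reflection\<close>

lemma ordered_eigenvalue_nets_moderate:
  assumes A: "mat_representative n A A'" and t: "ordered_eigenvalue_nets n A t" and k: "k \<in> {1..n}"
  shows "moderate (t k)"
proof -
  obtain b :: "real \<Rightarrow> real" where b: "moderate b" "\<forall>\<epsilon>. 0 \<le> b \<epsilon>" "\<forall>\<epsilon>. \<forall>i<n. \<forall>j<n. \<bar>A \<epsilon> $$ (i, j)\<bar> \<le> b \<epsilon>"
    using mat_representative_moderate_bound[OF A] by blast
  show ?thesis
  proof (rule moderate_dominated)
    show "moderate (\<lambda>\<epsilon>. (real n)\<^sup>2 * b \<epsilon>)"
      by (intro moderate_mult moderate_const b)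
    show "norm (t k \<epsilon>) \<le> norm ((real n)\<^sup>2 * b \<epsilon>)" if "\<epsilon> \<in> {0<..1}" for \<epsilon>
      using ordered_eigenvalues_cmod_le[OF mat_representativeD(2)[OF A that], of "\<lambda>k. t k \<epsilon>" "b \<epsilon>" k]
        t that b k by (simp add: ordered_eigenvalue_nets_def)
  qed
qed

lemma ordered_eigenvalue_nets_Re_negligible:
  assumes A: "mat_representative n A A'" and skew: "skew_symmetric_mat A'"
    and t: "ordered_eigenvalue_nets n A t" and k: "k \<in> {1..n}"
  shows "negligible (\<lambda>\<epsilon>. Re (t k \<epsilon>))"
proof -
  obtain h :: "real \<Rightarrow> real" where h: "negligible h" "\<forall>\<epsilon>. 0 \<le> h \<epsilon>" "\<forall>\<epsilon>\<in>{0<..1}. nearly_skew n (h \<epsilon>) (A \<epsilon>)"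
    using mat_representative_nearly_skew[OF A skew] by blast
  show ?thesis
  proof (rule negligible_dominated)
    show "negligible (\<lambda>\<epsilon>. (real n)\<^sup>2 * h \<epsilon>)"
      by (intro negligible_cmult h)
    show "norm (Re (t k \<epsilon>)) \<le> norm ((real n)\<^sup>2 * h \<epsilon>)" if "\<epsilon> \<in> {0<..1}" for \<epsilon>
      using nearly_skew_Re_eigenvalue_le[of n "h \<epsilon>" "A \<epsilon>" "\<lambda>k. t k \<epsilon>" k]
        t that h k by (simp add: ordered_eigenvalue_nets_def)
  qed
qed

lemma ordered_eigenvalue_nets_close:
  assumes A: "mat_representative n A A'" and B: "mat_representative n B A'"
    and skew: "skew_symmetric_mat A'"
    and s: "ordered_eigenvalue_nets n A s" and t: "ordered_eigenvalue_nets n B t" and k: "k \<in> {1..n}"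
  shows "negligible (\<lambda>\<epsilon>. s k \<epsilon> - t k \<epsilon>)"
proof -
  obtain h :: "real \<Rightarrow> real" where h: "negligible h" "\<forall>\<epsilon>. 0 \<le> h \<epsilon>" "\<forall>\<epsilon>\<in>{0<..1}. nearly_skew n (h \<epsilon>) (A \<epsilon>)"
    using mat_representative_nearly_skew[OF A skew] by blast
  obtain h' :: "real \<Rightarrow> real" where h': "negligible h'" "\<forall>\<epsilon>. 0 \<le> h' \<epsilon>" "\<forall>\<epsilon>\<in>{0<..1}. nearly_skew n (h' \<epsilon>) (B \<epsilon>)"
    using mat_representative_nearly_skew[OF B skew] by blast
  obtain d :: "real \<Rightarrow> real" where d: "negligible d" "\<forall>\<epsilon>. 0 \<le> d \<epsilon>"
      "\<forall>\<epsilon>. \<forall>i<n. \<forall>j<n. \<bar>A \<epsilon> $$ (i, j) - B \<epsilon> $$ (i, j)\<bar> \<le> d \<epsilon>"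
    using mat_representative_close[OF A B] by blast
  let ?c = "2 * (real n)\<^sup>2 + 2 * real n ^ 4 + real n ^ 3"
  \<comment> \<open>One net that dominates both skewness defects and the distance of the two
    representatives.\<close>
  let ?h = "\<lambda>\<epsilon>. h \<epsilon> + h' \<epsilon> + d \<epsilon>"
  show ?thesis
  proof (rule negligible_dominated)
    show "negligible (\<lambda>\<epsilon>. ?c * ?h \<epsilon>)"
      by (intro negligible_cmult negligible_add h h' d)
    fix \<epsilon> :: real assume e: "\<epsilon> \<in> {0<..1}"
    have le: "0 \<le> h \<epsilon>" "0 \<le> h' \<epsilon>" "0 \<le> d \<epsilon>"
      using h h' d by auto
    have "cmod (s k \<epsilon> - t k \<epsilon>) \<le> ?c * ?h \<epsilon>"
    proof (rule nearly_skew_eigenvalues_close[OF _ _ _ _ _ k, of "?h \<epsilon>" "A \<epsilon>" _ "B \<epsilon>"])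
      show "nearly_skew n (?h \<epsilon>) (A \<epsilon>)" "nearly_skew n (?h \<epsilon>) (B \<epsilon>)"
        using nearly_skew_mono[of n "h \<epsilon>" "A \<epsilon>" "?h \<epsilon>"] nearly_skew_mono[of n "h' \<epsilon>" "B \<epsilon>" "?h \<epsilon>"]
          h(3) h'(3) e le by auto
      show "\<bar>A \<epsilon> $$ (i, j) - B \<epsilon> $$ (i, j)\<bar> \<le> ?h \<epsilon>" if "i < n" "j < n" for i j
        using d(3)[rule_format, OF that, of \<epsilon>] le by linarith
      show "ordered_eigenvalues n (A \<epsilon>) (\<lambda>k. s k \<epsilon>)" "ordered_eigenvalues n (B \<epsilon>) (\<lambda>k. t k \<epsilon>)"
        using s t e by (auto simp: ordered_eigenvalue_nets_def)
    qed
    then show "norm (s k \<epsilon> - t k \<epsilon>) \<le> norm (?c * ?h \<epsilon>)"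
      by (metis abs_ge_self order_trans real_norm_def)
  qed
qed

text \<open>The reversed conjugate eigenvalues are another admissible enumeration for the same
  matrices, so they differ negligibly from \<open>t\<close>. Conjugation is negation up to twice the
  real part, which is negligible.\<close>

lemma ordered_eigenvalue_nets_reflect:
  assumes A: "mat_representative n A A'" and skew: "skew_symmetric_mat A'"
    and t: "ordered_eigenvalue_nets n A t" and k: "k \<in> {1..n}"
  shows "negligible (\<lambda>\<epsilon>. t (n + 1 - k) \<epsilon> + t k \<epsilon>)"
proof -
  have cnj: "ordered_eigenvalue_nets n A (\<lambda>k \<epsilon>. cnj (t (n + 1 - k) \<epsilon>))"
    unfolding ordered_eigenvalue_nets_def
    using t mat_representativeD(2)[OF A] ordered_eigenvalues_cnj unfolding ordered_eigenvalue_nets_def by blast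
  have k': "n + 1 - k \<in> {1..n}"
    using k by auto
  have "negligible (\<lambda>\<epsilon>. 2 * Re (t (n + 1 - k) \<epsilon>))"
    by (intro negligible_cmult ordered_eigenvalue_nets_Re_negligible[OF A skew t k'])
  then have "negligible (\<lambda>\<epsilon>. complex_of_real (2 * Re (t (n + 1 - k) \<epsilon>)))"
    by (rule negligible_dominated) simp
  from negligible_add[OF ordered_eigenvalue_nets_close[OF A A skew t cnj k] this]
  have "negligible (\<lambda>\<epsilon>. t k \<epsilon> - cnj (t (n + 1 - k) \<epsilon>) + complex_of_real (2 * Re (t (n + 1 - k) \<epsilon>)))" .
  moreover have "(\<lambda>\<epsilon>. t k \<epsilon> - cnj (t (n + 1 - k) \<epsilon>) + complex_of_real (2 * Re (t (n + 1 - k) \<epsilon>))) =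
      (\<lambda>\<epsilon>. t (n + 1 - k) \<epsilon> + t k \<epsilon>)"
    by (rule ext) (simp add: complex_eq_iff)
  ultimately show ?thesis
    by (simp only:)
qed

section \<open>Degeneracy in odd dimension\<close>

text \<open>For odd \<open>n\<close>, the unit kernel vectors of the skew parts form a nonzero
  generalized vector \<open>x\<close> that is annihilated from the left by
  \<open>A'\<close>.\<close>

lemma nondegenerate_skew_even:
  fixes A' :: "real colombeau mat"
  assumes A: "mat_representative n A A'" and skew: "skew_symmetric_mat A'" and nondeg: "nondegenerate_mat n A'"
  shows "even n"
proof (rule ccontr)
  assume n: "odd n"
  have "\<exists>x. (\<Sum>i<n. x i * x i) = 1 \<and> (\<forall>j<n. (\<Sum>i<n. x i * (A \<epsilon> $$ (i, j) - A \<epsilon> $$ (j, i))) = 0)"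
    if "\<epsilon> \<in> {0<..1}" for \<epsilon>
    by (rule odd_skew_part_kernel[OF mat_representativeD(2)[OF A that] n])
  then have "\<forall>\<epsilon>\<in>{0<..1}. \<exists>x. (\<Sum>i<n. x i * x i) = 1 \<and>
      (\<forall>j<n. (\<Sum>i<n. x i * (A \<epsilon> $$ (i, j) - A \<epsilon> $$ (j, i))) = 0)"
    by blast
  from bchoice[OF this] obtain X where X: "\<And>\<epsilon>. \<epsilon> \<in> {0<..1} \<Longrightarrow> (\<Sum>i<n. X \<epsilon> i * X \<epsilon> i) = 1"
    "\<And>\<epsilon> j. \<epsilon> \<in> {0<..1} \<Longrightarrow> j < n \<Longrightarrow> (\<Sum>i<n. X \<epsilon> i * (A \<epsilon> $$ (i, j) - A \<epsilon> $$ (j, i))) = 0"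
    by blast
  have X1: "\<bar>X \<epsilon> i\<bar> \<le> 1" if "\<epsilon> \<in> {0<..1}" "i < n" for \<epsilon> i
  proof -
    have "X \<epsilon> i * X \<epsilon> i \<le> (\<Sum>i<n. X \<epsilon> i * X \<epsilon> i)"
      using that(2) by (intro member_le_sum) auto
    then show ?thesis
      using X(1)[OF that(1)] by (simp add: abs_square_le_1 flip: power2_eq_square)
  qed
  have X_moderate: "moderate (\<lambda>\<epsilon>. X \<epsilon> i)" if "i < n" for i
    by (rule moderate_dominated[OF moderate_const[of "1::real"]]) (use X1 that in auto)
  obtain h :: "real \<Rightarrow> real" where h: "negligible h" "\<forall>\<epsilon>. 0 \<le> h \<epsilon>" "\<forall>\<epsilon>\<in>{0<..1}. nearly_skew n (h \<epsilon>) (A \<epsilon>)"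
    using mat_representative_nearly_skew[OF A skew] by blast
  define x where "x = vec n (\<lambda>i. colombeau_class (\<lambda>\<epsilon>. X \<epsilon> i))"
  have x: "x \<in> carrier_vec n"
    by (simp add: x_def)
  note A' = mat_representativeD(1)[OF A]
  have xA: "(\<Sum>i<n. x $ i * A' $$ (i, j)) = 0" if j: "j < n" for j
  proof -
    have "negligible (\<lambda>\<epsilon>. \<Sum>i<n. X \<epsilon> i * A \<epsilon> $$ (i, j))"
    proof (rule negligible_dominated)
      show "negligible (\<lambda>\<epsilon>. real n * h \<epsilon>)"
        by (intro negligible_cmult h)
      fix \<epsilon> :: real assume e: "\<epsilon> \<in> {0<..1}"
      \<comment> \<open>Twice a matrix is its skew part plus its symmetric part: \<open>X\<close>
        kills the first, and the second is bounded by the negligible \<open>h\<close>.\<close>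
      have "2 * (\<Sum>i<n. X \<epsilon> i * A \<epsilon> $$ (i, j)) = (\<Sum>i<n. X \<epsilon> i * (A \<epsilon> $$ (i, j) + A \<epsilon> $$ (j, i)))"
        using X(2)[OF e j] by (simp add: algebra_simps sum.distrib sum_subtractf)
      also have "\<bar>\<dots>\<bar> \<le> (\<Sum>i<n. 1 * h \<epsilon>)"
        unfolding real_norm_def[symmetric]
        by (intro sum_norm_le, subst norm_mult, intro mult_mono)
          (use nearly_skewD(2)[OF h(3)[rule_format, OF e], OF _ j] X1[OF e] in auto)
      finally show "norm (\<Sum>i<n. X \<epsilon> i * A \<epsilon> $$ (i, j)) \<le> norm (real n * h \<epsilon>)"
        by simp
    qed
    moreover have "(\<Sum>i<n. x $ i * A' $$ (i, j)) =
        (\<Sum>i<n. colombeau_class (\<lambda>\<epsilon>. X \<epsilon> i * A \<epsilon> $$ (i, j)))"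
      using X_moderate mat_representativeD(3,4)[OF A] j by (simp add: x_def colombeau_class_mult)
    moreover have "\<dots> = colombeau_class (\<lambda>\<epsilon>. \<Sum>i<n. X \<epsilon> i * A \<epsilon> $$ (i, j))"
      using X_moderate mat_representativeD(3)[OF A] j by (intro colombeau_class_sum moderate_mult) auto
    moreover have "moderate (\<lambda>\<epsilon>. \<Sum>i<n. X \<epsilon> i * A \<epsilon> $$ (i, j))"
      using X_moderate mat_representativeD(3)[OF A] j by (intro moderate_sum moderate_mult) auto
    ultimately show ?thesis
      by (simp add: colombeau_class_eq_0_iff)
  qed
  have "x \<bullet> (A' *\<^sub>v y) = 0" if y: "y \<in> carrier_vec n" for y
  proof -
    have "x \<bullet> (A' *\<^sub>v y) = (\<Sum>i<n. x $ i * (\<Sum>j<n. A' $$ (i, j) * y $ j))"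
      using A' x y by (simp add: scalar_prod_def atLeast0LessThan)
    also have "\<dots> = (\<Sum>i<n. \<Sum>j<n. x $ i * A' $$ (i, j) * y $ j)"
      by (simp add: sum_distrib_left mult.assoc)
    also have "\<dots> = (\<Sum>j<n. (\<Sum>i<n. x $ i * A' $$ (i, j)) * y $ j)"
      by (subst sum.swap) (simp add: sum_distrib_right)
    finally show ?thesis
      using xA by simp
  qed
  then have "x = 0\<^sub>v n"
    using nondeg x by (simp add: nondegenerate_mat_def)
  then have "negligible (\<lambda>\<epsilon>. X \<epsilon> i)" if "i < n" for i
    using that X_moderate[OF that] colombeau_class_eq_0_iff[of "\<lambda>\<epsilon>. X \<epsilon> i"]
    by (metis index_vec index_zero_vec(1) x_def)
  \<comment> \<open>The sum of squares is constantly 1 on the index interval, so it cannot be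
    negligible.\<close>
  then have "negligible (\<lambda>\<epsilon>. \<Sum>i<n. X \<epsilon> i * X \<epsilon> i)"
    using X_moderate by (intro negligible_sum negligible_mult) auto
  then have "negligible (\<lambda>_. 1 :: real)"
    by (rule negligible_dominated) (use X(1) in auto)
  then show False
    using not_negligible_one by blast
qed

section \<open>Eigenvalues over the generalized numbers\<close>

lemma gen_eigenvalue_interleaving:
  assumes A: "mat_representative n A A'" and skew: "skew_symmetric_mat A'"
    and t: "ordered_eigenvalue_nets n A t"
    and eig: "gen_eigenvalue n (map_mat complex_of_gen A') l"
  shows "interleaving n (\<lambda>k. colombeau_class (t k)) l"
proof -
  obtain x where free: "free_vec n x" and Ax: "map_mat complex_of_gen A' *\<^sub>v x = l \<cdot>\<^sub>v x"
    using eig by (auto simp: gen_eigenvalue_def)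
  have x: "x \<in> carrier_vec n"
    using free by (simp add: free_vec_def)
  \<comment> \<open>In dimension 0 the scalar 1 annihilates the only vector, so no vector is free.
    Positivity ensures that a closest eigenvalue exists.\<close>
  have n: "0 < n"
  proof (rule ccontr)
    assume "\<not> 0 < n"
    then have "1 \<cdot>\<^sub>v x = 0\<^sub>v n"
      using x by (intro eq_vecI) auto
    then show False
      using free unfolding free_vec_def by (metis one_neq_zero)
  qed
  obtain L where L: "moderate L" "l = colombeau_class L"
    by (rule colombeau_class_exhaust)
  have "\<forall>i. \<exists>r. moderate r \<and> x $ i = colombeau_class r"
    using colombeau_class_exhaust by metis
  then obtain X where X: "\<And>i. moderate (X i)" "\<And>i. x $ i = colombeau_class (X i)"
    by metis
  obtain h :: "real \<Rightarrow> real" where h: "negligible h" "\<forall>\<epsilon>. 0 \<le> h \<epsilon>" "\<forall>\<epsilon>\<in>{0<..1}. nearly_skew n (h \<epsilon>) (A \<epsilon>)"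
    using mat_representative_nearly_skew[OF A skew] by blast
  note A' = mat_representativeD(1)[OF A]
  have t_moderate: "moderate (t k)" if "k \<in> {1..n}" for k
    by (rule ordered_eigenvalue_nets_moderate[OF A t that])
  define R where "R i \<epsilon> = (\<Sum>j<n. complex_of_real (A \<epsilon> $$ (i, j)) * X j \<epsilon>) - L \<epsilon> * X i \<epsilon>" for i \<epsilon>
  have R: "negligible (R i)" if i: "i < n" for i
  proof -
    have AX: "moderate (\<lambda>\<epsilon>. complex_of_real (A \<epsilon> $$ (i, j)) * X j \<epsilon>)" if "j < n" for j
      using mat_representativeD(3)[OF A i that] X by (intro moderate_mult moderate_of_real)
    have "(map_mat complex_of_gen A' *\<^sub>v x) $ i = (\<Sum>j<n. complex_of_gen (A' $$ (i, j)) * x $ j)"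
      using A' x i by (simp add: scalar_prod_def atLeast0LessThan)
    also have "\<dots> = (\<Sum>j<n. colombeau_class (\<lambda>\<epsilon>. complex_of_real (A \<epsilon> $$ (i, j)) * X j \<epsilon>))"
      using mat_representativeD(3,4)[OF A i] X
      by (simp add: complex_of_gen_class colombeau_class_mult moderate_of_real)
    also have "\<dots> = colombeau_class (\<lambda>\<epsilon>. \<Sum>j<n. complex_of_real (A \<epsilon> $$ (i, j)) * X j \<epsilon>)"
      using AX by (intro colombeau_class_sum) auto
    also have "(map_mat complex_of_gen A' *\<^sub>v x) $ i = colombeau_class (\<lambda>\<epsilon>. L \<epsilon> * X i \<epsilon>)"
      unfolding Ax using x i L X by (simp add: colombeau_class_mult)
    finally show ?thesis
      unfolding R_def using AX L X
      by (subst (asm) eq_commute, subst (asm) colombeau_class_eq_iff)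
        (auto intro: moderate_sum moderate_mult)
  qed
  have "\<forall>\<epsilon>. \<exists>k\<in>{1..n}. \<forall>m\<in>{1..n}. cmod (t k \<epsilon> - L \<epsilon>) \<le> cmod (t m \<epsilon> - L \<epsilon>)"
  proof
    fix \<epsilon>
    show "\<exists>k\<in>{1..n}. \<forall>m\<in>{1..n}. cmod (t k \<epsilon> - L \<epsilon>) \<le> cmod (t m \<epsilon> - L \<epsilon>)"
      using ex_min_if_finite[of "(\<lambda>k. cmod (t k \<epsilon> - L \<epsilon>)) ` {1..n}"] n by (auto simp: not_less)
  qed
  then obtain K where K: "\<And>\<epsilon>. K \<epsilon> \<in> {1..n}"
    "\<And>\<epsilon> m. m \<in> {1..n} \<Longrightarrow> cmod (t (K \<epsilon>) \<epsilon> - L \<epsilon>) \<le> cmod (t m \<epsilon> - L \<epsilon>)"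
    by metis
  \<comment> \<open>The modulus of \<open>M \<epsilon>\<close> is the distance from
    \<open>L \<epsilon>\<close> to the spectrum of \<open>A \<epsilon>\<close>; it will be the
    \<open>d\<close> of \<open>nearly_skew_approx_eigenvector\<close>.\<close>
  define M where "M \<epsilon> = t (K \<epsilon>) \<epsilon> - L \<epsilon>" for \<epsilon>
  \<comment> \<open>By minimality, comparison with the single index 1 suffices.\<close>
  have M: "moderate M"
  proof (rule moderate_dominated)
    show "moderate (\<lambda>\<epsilon>. t 1 \<epsilon> - L \<epsilon>)"
      using n by (intro moderate_diff t_moderate L) auto
    show "norm (M \<epsilon>) \<le> norm (t 1 \<epsilon> - L \<epsilon>)" for \<epsilon>
      unfolding M_def using K(2) n by simp
  qed
  have MX: "negligible (\<lambda>\<epsilon>. M \<epsilon> * X j \<epsilon>)" if j: "j < n" for j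
  proof (rule negligible_dominated)
    let ?r = "\<lambda>\<epsilon>. \<Sum>i<n. cmod (R i \<epsilon>)" and ?c = "\<lambda>\<epsilon>. \<Sum>i<n. cmod (X i \<epsilon>)"
    \<comment> \<open>The residuals \<open>R i\<close> are negligible by the eigenvalue equation;
      the other term is the negligible defect \<open>h\<close> times a moderate net.\<close>
    show "negligible (\<lambda>\<epsilon>. (real n)\<^sup>2 * ?r \<epsilon> + real n ^ 5 * (h \<epsilon> * ?c \<epsilon>))"
      using R X h
      by (intro negligible_add negligible_cmult negligible_mult negligible_sum moderate_sum
          negligible_norm moderate_norm) auto
    fix \<epsilon> :: real assume e: "\<epsilon> \<in> {0<..1}"
    have Ae: "A \<epsilon> \<in> carrier_mat n n"
      by (rule mat_representativeD(2)[OF A e])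
    let ?x = "vec n (\<lambda>i. X i \<epsilon>)"
    have le: "cmod (f i) \<le> (\<Sum>i<n. cmod (f i))" if "i < n" for f :: "nat \<Rightarrow> complex" and i
      using that by (intro member_le_sum) auto
    have "cmod (?x $ j) * cmod (M \<epsilon>) \<le> (real n)\<^sup>2 * ?r \<epsilon> + real n ^ 5 * (h \<epsilon> * ?c \<epsilon>)"
    proof (rule nearly_skew_approx_eigenvector[where A = "A \<epsilon>" and t = "\<lambda>k. t k \<epsilon>" and l = "L \<epsilon>"])
      show "nearly_skew n (h \<epsilon>) (A \<epsilon>)"
        using h e by blast
      show "ordered_eigenvalues n (A \<epsilon>) (\<lambda>k. t k \<epsilon>)"
        using t e by (simp add: ordered_eigenvalue_nets_def)
      show "\<forall>i<n. cmod (?x $ i) \<le> ?c \<epsilon>"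
        using le[of _ "\<lambda>i. X i \<epsilon>"] by simp
      have "(map_mat complex_of_real (A \<epsilon>) *\<^sub>v ?x - L \<epsilon> \<cdot>\<^sub>v ?x) $ i = R i \<epsilon>" if "i < n" for i
        using that Ae by (simp add: R_def scalar_prod_def atLeast0LessThan)
      then show "\<forall>i<n. cmod ((map_mat complex_of_real (A \<epsilon>) *\<^sub>v ?x - L \<epsilon> \<cdot>\<^sub>v ?x) $ i) \<le> ?r \<epsilon>"
        using le[of _ "\<lambda>i. R i \<epsilon>"] by simp
      show "cmod (M \<epsilon>) \<le> cmod (t k \<epsilon> - L \<epsilon>)" if "k \<in> {1..n}" for k
        unfolding M_def using K(2)[OF that] .
    qed (use j in auto)
    then have "cmod (M \<epsilon> * X j \<epsilon>) \<le> (real n)\<^sup>2 * ?r \<epsilon> + real n ^ 5 * (h \<epsilon> * ?c \<epsilon>)"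
      using j by (simp add: norm_mult mult.commute)
    then show "norm (M \<epsilon> * X j \<epsilon>) \<le> norm ((real n)\<^sup>2 * ?r \<epsilon> + real n ^ 5 * (h \<epsilon> * ?c \<epsilon>))"
      by (metis abs_ge_self order_trans real_norm_def)
  qed
  have "colombeau_class M \<cdot>\<^sub>v x = 0\<^sub>v n"
  proof (rule eq_vecI)
    fix i assume "i < dim_vec (0\<^sub>v n :: complex colombeau vec)"
    then have i: "i < n"
      by simp
    then show "(colombeau_class M \<cdot>\<^sub>v x) $ i = 0\<^sub>v n $ i"
      using x MX[OF i] M X by (simp add: colombeau_class_mult colombeau_class_eq_0_iff moderate_mult)
  qed (use x in simp)
  then have "colombeau_class M = 0"
    using free by (simp add: free_vec_def)
  then have M0: "negligible M"
    using M by (simp add: colombeau_class_eq_0_iff)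
  define S where "S k = {\<epsilon> \<in> {0<..1}. K \<epsilon> = k}" for k
  have ind: "moderate (indicator (S k) :: real \<Rightarrow> complex)" for k
    by (rule moderate_dominated[OF moderate_const[of "1::complex"]]) (simp add: indicator_def)
  let ?sum = "\<lambda>\<epsilon>. \<Sum>k\<in>{1..n}. t k \<epsilon> * indicator (S k) \<epsilon>"
  have "(\<Sum>k\<in>{1..n}. colombeau_class (t k) * gen_indicator (S k)) =
      (\<Sum>k\<in>{1..n}. colombeau_class (\<lambda>\<epsilon>. t k \<epsilon> * indicator (S k) \<epsilon>))"
    using t_moderate ind by (simp add: gen_indicator_def colombeau_class_mult)
  also have "\<dots> = colombeau_class ?sum"
    using t_moderate ind by (intro colombeau_class_sum moderate_mult) auto
  also have "\<dots> = l"
  proof -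
    have "moderate ?sum"
      using t_moderate ind by (intro moderate_sum moderate_mult) auto
    moreover have "negligible (\<lambda>\<epsilon>. ?sum \<epsilon> - L \<epsilon>)"
    proof (rule negligible_dominated[OF M0])
      fix \<epsilon> :: real assume e: "\<epsilon> \<in> {0<..1}"
      \<comment> \<open>Exactly one indicator is 1 at each \<open>\<epsilon>\<close>, so the sum
        picks the closest eigenvalue and its difference from \<open>L \<epsilon>\<close> is exactly
        \<open>M \<epsilon>\<close>.\<close>
      have "?sum \<epsilon> = (\<Sum>k\<in>{1..n}. if k = K \<epsilon> then t k \<epsilon> else 0)"
        using e by (intro sum.cong) (auto simp: S_def indicator_def)
      also have "\<dots> = t (K \<epsilon>) \<epsilon>"
        using K(1)[of \<epsilon>] by (simp add: sum.delta)
      finally show "norm (?sum \<epsilon> - L \<epsilon>) \<le> norm (M \<epsilon>)"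
        by (simp add: M_def)
    qed
    ultimately show ?thesis
      using L by (simp add: colombeau_class_eq_iff)
  qed
  finally have "l = (\<Sum>k\<in>{1..n}. colombeau_class (t k) * gen_indicator (S k))" ..
  moreover have "disjoint_family_on S {1..n}"
    by (auto simp: disjoint_family_on_def S_def)
  moreover have "(\<Union>k\<in>{1..n}. S k) = {0<..1}"
    using K(1) by (auto simp: S_def)
  ultimately show ?thesis
    unfolding interleaving_def by blast
qed

theorem proposition3p26:
  fixes n :: nat
    and A :: "real colombeau mat"
    and A\<^sub>\<epsilon> :: "real \<Rightarrow> real mat"
    and \<theta> :: "nat \<Rightarrow> real \<Rightarrow> complex"
  assumes "A \<in> carrier_mat n n"
    and "skew_symmetric_mat A"
    and "mat_representative n A\<^sub>\<epsilon> A"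
    and "ordered_eigenvalue_nets n A\<^sub>\<epsilon> \<theta>"
  shows
    "(\<forall>k\<in>{1..n}. moderate (\<theta> k)) \<and>
     (\<forall>B\<^sub>\<epsilon> \<eta>. mat_representative n B\<^sub>\<epsilon> A \<longrightarrow> ordered_eigenvalue_nets n B\<^sub>\<epsilon> \<eta> \<longrightarrow>
        (\<forall>k\<in>{1..n}. moderate (\<eta> k) \<and> colombeau_class (\<eta> k) = colombeau_class (\<theta> k))) \<and>
     (\<exists>l :: nat \<Rightarrow> real colombeau.
        (\<forall>k\<in>{1..n}. colombeau_class (\<theta> k) = gen_ii * complex_of_gen (l k) \<or>
                     colombeau_class (\<theta> k) = - (gen_ii * complex_of_gen (l k))) \<and>
        (\<forall>k\<in>{1..n}. colombeau_class (\<theta> (n + 1 - k)) = - colombeau_class (\<theta> k)) \<and>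
        (odd n \<longrightarrow> (\<exists>k\<in>{1..n}. l k = 0))) \<and>
     (nondegenerate_mat n A \<longrightarrow> even n) \<and>
     (\<forall>l. gen_eigenvalue n (map_mat complex_of_gen A) l \<longrightarrow>
        interleaving n (\<lambda>k. colombeau_class (\<theta> k)) l)"
proof -
  note skew = assms(2) and A = assms(3) and t = assms(4)
  have mod: "moderate (\<theta> k)" if "k \<in> {1..n}" for k
    by (rule ordered_eigenvalue_nets_moderate[OF A t that])
  have indep: "moderate (\<eta> k) \<and> colombeau_class (\<eta> k) = colombeau_class (\<theta> k)"
    if "mat_representative n B A" "ordered_eigenvalue_nets n B \<eta>" "k \<in> {1..n}" for B \<eta> k
    using ordered_eigenvalue_nets_moderate[OF that] mod[OF that(3)]
      ordered_eigenvalue_nets_close[OF that(1) A skew that(2) t that(3)]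
    by (simp add: colombeau_class_eq_iff)
  \<comment> \<open>With the imaginary parts as \<open>l k\<close>, it is always the plus sign that
    holds.\<close>
  define l where "l k = colombeau_class (\<lambda>\<epsilon>. Im (\<theta> k \<epsilon>))" for k
  have Im_mod: "moderate (\<lambda>\<epsilon>. Im (\<theta> k \<epsilon>))" if "k \<in> {1..n}" for k
    by (rule moderate_dominated[OF mod[OF that]]) (simp add: abs_Im_le_cmod)
  have imaginary: "colombeau_class (\<theta> k) = gen_ii * complex_of_gen (l k)" if k: "k \<in> {1..n}" for k
  proof -
    have "gen_ii * complex_of_gen (l k) = colombeau_class (\<lambda>\<epsilon>. \<i> * complex_of_real (Im (\<theta> k \<epsilon>)))"
      using Im_mod[OF k]
      by (simp add: gen_ii_def l_def complex_of_gen_class colombeau_class_mult moderate_of_real)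
    moreover have "negligible (\<lambda>\<epsilon>. \<theta> k \<epsilon> - \<i> * complex_of_real (Im (\<theta> k \<epsilon>)))"
    proof (rule negligible_dominated[OF ordered_eigenvalue_nets_Re_negligible[OF A skew t k]])
      have "z - \<i> * complex_of_real (Im z) = complex_of_real (Re z)" for z
        by (simp add: complex_eq_iff)
      then show "norm (\<theta> k \<epsilon> - \<i> * complex_of_real (Im (\<theta> k \<epsilon>))) \<le> norm (Re (\<theta> k \<epsilon>))" for \<epsilon>
        by simp
    qed
    ultimately show ?thesis
      using mod[OF k] Im_mod[OF k] by (simp add: colombeau_class_eq_iff moderate_mult moderate_of_real)
  qed
  have reflect: "colombeau_class (\<theta> (n + 1 - k)) = - colombeau_class (\<theta> k)" if k: "k \<in> {1..n}" for k
  proof -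
    have "n + 1 - k \<in> {1..n}"
      using k by auto
    then show ?thesis
      using ordered_eigenvalue_nets_reflect[OF A skew t k] mod k
      by (simp add: colombeau_class_minus colombeau_class_eq_iff moderate_minus)
  qed
  have "\<exists>k\<in>{1..n}. l k = 0" if odd: "odd n"
  proof -
    \<comment> \<open>The middle index \<open>m + 1\<close> is fixed under
      \<open>k \<mapsto> n + 1 - k\<close>, so reflection makes twice the middle eigenvalue
      negligible.\<close>
    obtain m where m: "n = 2 * m + 1"
      using odd by (rule oddE)
    then have k: "m + 1 \<in> {1..n}" and "n + 1 - (m + 1) = m + 1"
      by auto
    then have "negligible (\<lambda>\<epsilon>. \<theta> (m + 1) \<epsilon> + \<theta> (m + 1) \<epsilon>)"
      using ordered_eigenvalue_nets_reflect[OF A skew t k] by simp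
    then have "negligible (\<lambda>\<epsilon>. Im (\<theta> (m + 1) \<epsilon>))"
    proof (rule negligible_dominated)
      show "norm (Im (\<theta> (m + 1) \<epsilon>)) \<le> norm (\<theta> (m + 1) \<epsilon> + \<theta> (m + 1) \<epsilon>)" for \<epsilon>
        using abs_Im_le_cmod[of "\<theta> (m + 1) \<epsilon>"] by (simp add: norm_mult flip: mult_2)
    qed
    then show ?thesis
      using k Im_mod[OF k] by (intro bexI[of _ "m + 1"]) (auto simp: l_def colombeau_class_eq_0_iff)
  qed
  then show ?thesis
    using mod indep imaginary reflect nondegenerate_skew_even[OF A skew]
      gen_eigenvalue_interleaving[OF A skew t]
    by blast
qed

end
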